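(* Let $\Bbbk$ be a field and let $X$ be a convex polyomino such that its vertex set $V(X)$ is a sublattice of $\mathbb{N}^2$. Let $h(t) = 1 + h_1 t + h_2 t^2 + \cdots$ be the $h$-polynomial of $\Bbbk[X]$ and let $r(t) = 1 + r_1 t + r_2 t^2 + \cdots$ be the rook polynomial of $X$. If $X$ is not thin, then $h_2 < r_2$. In particular, $h(t) \neq r(t)$.
   Context: A cell in $\mathbb{R}^2$ is a set $\{(x,y)\in\mathbb{R}^2 \mid a\le x\le a+1,\ b\le y\le b+1\}$ with $(a,b)\in\mathbb{Z}^2$. A polyomino $X$ is a finite union of cells that is connected and has no finite cut-set (removing any finite set of points from $X$ leaves it connected). $X$ is horizontally (respectively vertically) convex if every line segment parallel to the $x$-axis (respectively $y$-axis) with end-points in $X$ is contained in $X$; $X$ is convex if it is both horizontally and vertically convex. The vertex set of $X$ is $V(X)=X\cap\mathbb{Z}^2$. $\mathbb{N}$ denotes the nonnegative integers. $\mathbb{R}^2$ carries the componentwise partial order: $(a_1,a_2)\le(b_1,b_2)$ iff $a_1\le b_1$ and $a_2\le b_2$; "sublattice of $\mathbb{N}^2$" means a subset of $\mathbb{N}^2$ closed under componentwise minimum (meet) and componentwise maximum (join). $X$ is thin if it does not contain a $2\times 2$ square of four cells. For a convex polyomino $X$, let $R=\Bbbk[x_v \mid v\in V(X)]$ be the polynomial ring, and let $I_X$ be the ideal of $R$ generated by the binomials $x_ax_b-x_cx_d$ where $a\le b$ are in $V(X)$ and $c,d\in V(X)$ are the other two corners of the rectangle with bottom-left corner $a$ and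 top-right corner $b$ (only those pairs $a\le b$ for which both other corners lie in $V(X)$ are used). Set $\Bbbk[X]=R/I_X$, with the standard grading ($\deg x_v=1$). The $h$-polynomial of a standard graded $\Bbbk$-algebra $A$ is the unique polynomial $h(t)\in\mathbb{Z}[t]$ such that the Hilbert series of $A$ is $h(t)/(1-t)^{d}$, where $d=\dim A$ is the Krull dimension. For $k\in\mathbb{N}$, a $k$-rook configuration in $X$ is an arrangement of $k$ (indistinguishable) rooks on distinct cells of $X$ in pairwise non-attacking positions; for convex $X$ this is a set of $k$ cells of $X$, no two of which lie in the same row or the same column. Let $r_k$ be the number of $k$-rook configurations in $X$. The rook polynomial of $X$ is $r(t)=\sum_{k\in\mathbb{N}} r_kt^k$. *)

theory Defs
  imports
    "HOL-Analysis.Analysis"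
    "HOL-Algebra.Embedded_Algebras"
    "HOL-Algebra.QuotRing"
    "HOL-Library.Poly_Mapping"
    "HOL-Library.Extended_Nat"
    "HOL-Computational_Algebra.Polynomial_FPS"
begin

section \<open>Polyominoes\<close>

definition unit_cell :: "int \<times> int \<Rightarrow> (real \<times> real) set" where
  "unit_cell = (\<lambda>(a, b). {real_of_int a .. real_of_int a + 1} \<times> {real_of_int b .. real_of_int b + 1})"

definition polyomino :: "(real \<times> real) set \<Rightarrow> bool" where
  "polyomino X \<longleftrightarrow>
     (\<exists>C. finite C \<and> X = (\<Union>c\<in>C. unit_cell c)) \<and>
     connected X \<and> (\<forall>F. finite F \<and> F \<subseteq> X \<longrightarrow> connected (X - F))"

definition horizontally_convex :: "(real \<times> real) set \<Rightarrow> bool" where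
  "horizontally_convex X \<longleftrightarrow> (\<forall>p\<in>X. \<forall>q\<in>X. snd p = snd q \<longrightarrow> closed_segment p q \<subseteq> X)"

definition vertically_convex :: "(real \<times> real) set \<Rightarrow> bool" where
  "vertically_convex X \<longleftrightarrow> (\<forall>p\<in>X. \<forall>q\<in>X. fst p = fst q \<longrightarrow> closed_segment p q \<subseteq> X)"

definition convex_polyomino :: "(real \<times> real) set \<Rightarrow> bool" where
  "convex_polyomino X \<longleftrightarrow> polyomino X \<and> horizontally_convex X \<and> vertically_convex X"

definition vertex_set :: "(real \<times> real) set \<Rightarrow> (real \<times> real) set" where
  "vertex_set X = X \<inter> (\<int> \<times> \<int>)"

text \<open>The order, \<^const>\<open>inf\<close> and \<^const>\<open>sup\<close> on pairs are the componentwise ones.\<close>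

definition sublattice_of_N2 :: "(real \<times> real) set \<Rightarrow> bool" where
  "sublattice_of_N2 L \<longleftrightarrow>
     L \<subseteq> \<nat> \<times> \<nat> \<and> (\<forall>u\<in>L. \<forall>v\<in>L. inf u v \<in> L \<and> sup u v \<in> L)"

text \<open>
  Cells are represented by their lower left corners. A cell contained in a finite union of cells
  is one of them, so these are the cells that make up a polyomino.
\<close>

definition cells :: "(real \<times> real) set \<Rightarrow> (int \<times> int) set" where
  "cells X = {c. unit_cell c \<subseteq> X}"

definition thin :: "(real \<times> real) set \<Rightarrow> bool" where
  "thin X \<longleftrightarrow> \<not> (\<exists>a b. {(a, b), (a + 1, b), (a, b + 1), (a + 1, b + 1)} \<subseteq> cells X)"


section \<open>The rook polynomial\<close>

text \<open>
  Rooks in a common row or column always attack each other here. This is the right notion for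
  convex polyominoes, where no gap can separate two cells of the same row or column.
\<close>

definition rook_configurations :: "(real \<times> real) set \<Rightarrow> nat \<Rightarrow> (int \<times> int) set set" where
  "rook_configurations X k =
     {S. S \<subseteq> cells X \<and> finite S \<and> card S = k \<and>
         (\<forall>c\<in>S. \<forall>d\<in>S. c \<noteq> d \<longrightarrow> fst c \<noteq> fst d \<and> snd c \<noteq> snd d)}"

definition rook_number :: "(real \<times> real) set \<Rightarrow> nat \<Rightarrow> nat" where
  "rook_number X k = card (rook_configurations X k)"

text \<open>There are no configurations of more than \<^term>\<open>card (cells X)\<close> rooks.\<close>

definition rook_polynomial :: "(real \<times> real) set \<Rightarrow> int poly" where
  "rook_polynomial X = (\<Sum>k\<le>card (cells X). Polynomial.monom (int (rook_number X k)) k)"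


section \<open>The \<open>h\<close>-polynomial of a standard graded algebra\<close>

definition krull_dimension :: "('a, 'b) ring_scheme \<Rightarrow> enat" where
  "krull_dimension A =
     (SUP n \<in> {n. \<exists>P. (\<forall>i\<le>n. primeideal (P i) A) \<and> (\<forall>i<n. P i \<subset> P (Suc i))}. enat n)"

text \<open>
  Below, \<open>K \<subseteq> carrier A\<close> is the coefficient field of the algebra \<open>A\<close>, and \<open>G n \<subseteq> carrier A\<close> is
  its homogeneous component of degree \<open>n\<close>.
\<close>

definition hilbert_series ::
    "('a, 'b) ring_scheme \<Rightarrow> 'a set \<Rightarrow> (nat \<Rightarrow> 'a set) \<Rightarrow> int fps" where
  "hilbert_series A K G = Abs_fps (\<lambda>n. int (ring.dim A K (G n)))"

definition h_polynomial ::
    "('a, 'b) ring_scheme \<Rightarrow> 'a set \<Rightarrow> (nat \<Rightarrow> 'a set) \<Rightarrow> int poly" where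
  "h_polynomial A K G =
     (THE h. \<exists>d. krull_dimension A = enat d \<and>
                 hilbert_series A K G * (1 - fps_X) ^ d = fps_of_poly h)"


section \<open>The algebra of a convex polyomino\<close>

text \<open>
  A monomial is its exponent function \<open>'v \<Rightarrow>\<^sub>0 nat\<close>, and a polynomial in variables indexed by
  \<open>'v\<close> is its coefficient function on monomials; multiplication of \<open>\<Rightarrow>\<^sub>0\<close> is convolution.
\<close>

type_synonym ('v, 'k) mpoly = "('v \<Rightarrow>\<^sub>0 nat) \<Rightarrow>\<^sub>0 'k"

definition poly_ring :: "'v set \<Rightarrow> ('v, 'k::field) mpoly ring" where
  "poly_ring V =
     \<lparr>carrier = {p. \<forall>m\<in>Poly_Mapping.keys p. Poly_Mapping.keys m \<subseteq> V},
      mult = (*), one = 1, zero = 0, add = (+)\<rparr>"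

definition var :: "'v \<Rightarrow> ('v, 'k::field) mpoly" where
  "var v = Poly_Mapping.single (Poly_Mapping.single v 1) 1"

definition constants :: "('v, 'k::field) mpoly set" where
  "constants = (\<lambda>c. Poly_Mapping.single 0 c) ` UNIV"

definition monomial_degree :: "('v \<Rightarrow>\<^sub>0 nat) \<Rightarrow> nat" where
  "monomial_degree m = (\<Sum>v\<in>Poly_Mapping.keys m. Poly_Mapping.lookup m v)"

definition homogeneous_polys :: "'v set \<Rightarrow> nat \<Rightarrow> ('v, 'k::field) mpoly set" where
  "homogeneous_polys V n =
     {p \<in> carrier (poly_ring V). \<forall>m\<in>Poly_Mapping.keys p. monomial_degree m = n}"

definition polyomino_ideal :: "(real \<times> real) set \<Rightarrow> (real \<times> real, 'k::field) mpoly set" where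
  "polyomino_ideal X =
     Idl\<^bsub>poly_ring (vertex_set X)\<^esub>
       {var a * var b - var (fst b, snd a) * var (fst a, snd b) | a b.
          a \<in> vertex_set X \<and> b \<in> vertex_set X \<and> a \<le> b \<and>
          (fst b, snd a) \<in> vertex_set X \<and> (fst a, snd b) \<in> vertex_set X}"

definition polyomino_algebra ::
    "'k::field itself \<Rightarrow> (real \<times> real) set \<Rightarrow> (real \<times> real, 'k) mpoly set ring" where
  "polyomino_algebra _ X = poly_ring (vertex_set X) Quot polyomino_ideal X"

text \<open>The image of a set of polynomials under the projection onto the quotient ring.\<close>

definition polyomino_class ::
    "(real \<times> real) set \<Rightarrow> (real \<times> real, 'k::field) mpoly set \<Rightarrow> (real \<times> real, 'k) mpoly set set"
    where
  "polyomino_class X S = (\<lambda>p. polyomino_ideal X +>\<^bsub>poly_ring (vertex_set X)\<^esub> p) ` S"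

definition polyomino_h_polynomial :: "'k::field itself \<Rightarrow> (real \<times> real) set \<Rightarrow> int poly" where
  "polyomino_h_polynomial k X =
     h_polynomial (polyomino_algebra k X)
       (polyomino_class X constants)
       (\<lambda>n. polyomino_class X (homogeneous_polys (vertex_set X) n))"

end

theory Submission
  imports Defs
begin

text \<open>
  The algebra \<open>k[X]\<close> is the Hibi ring of the planar lattice \<open>V(X)\<close>: monomials supported on chains
  form a basis. They span by straightening, and they are independent because \<open>x\<^bsub>(i,j)\<^esub> \<mapsto> s\<^sub>i t\<^sub>j\<close>
  kills the ideal and separates them. Hence the Krull dimension is the size \<open>d\<close> of a maximal chain,
  and \<open>h(t)\<close> is the sum of \<open>t\<^bsup>\<bar>C\<bar>\<^esup> (1 - t)\<^bsup>d - \<bar>C\<bar>\<^esup>\<close> over all chains \<open>C\<close>.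

  On each antidiagonal the vertices are consecutive and the cells are the gaps between neighbours,
  so there is exactly one vertex more than there are cells. Applying this count to all intervals
  of the lattice shows that \<open>h\<^sub>2\<close> is the number of pairs of cells one of which lies strictly above
  and to the right of the other. Such pairs are 2-rook configurations, and the antidiagonal of a
  two by two square is a 2-rook configuration that is not of this kind.
\<close>

section \<open>Planar lattices\<close>

text \<open>Expanding the sum over chains gives
  \<open>h_2 = (d choose 2) - (d - 1) * card V + p\<close>, where \<open>p\<close> is the number of
  pairs \<open>u < v\<close> of vertices, so the combinatorial task is to compute \<open>p\<close>.
  The antidiagonal count replaces the vertices above a given one by the cells above it plus a
  difference of ranks. After exchanging the two summations it is applied once more, to the vertices
  below a cell, and produces the pairs of cells. The corrections collected on the way are exactly
  what cancels the first two terms of \<open>h_2\<close> when \<open>d\<close> is the number of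
  ranks.

  On the algebraic side the obstacle is the Krull dimension, which is defined by chains of primes.
  Kernels of toric maps that kill some of the variables are explicit primes and give the lower
  bound. The upper bound compares growth: a long chain of primes would force more linearly
  independent elements of bounded degree than there are chain monomials to span them. The toric map
  serves here as well, since it turns independence modulo the ideal into linear independence in a
  vector space.\<close>

definition coord_sum :: "int \<times> int \<Rightarrow> int" where
  "coord_sum p = fst p + snd p"

lemma coord_sum_strict_mono: "u < v \<Longrightarrow> coord_sum u < coord_sum v" for u v :: "int \<times> int"
  by (auto simp: coord_sum_def less_le_not_le less_eq_prod_def)

lemma coord_sum_mono: "u \<le> v \<Longrightarrow> coord_sum u \<le> coord_sum v" for u v :: "int \<times> int"
  by (auto simp: coord_sum_def less_eq_prod_def)

text \<open>
  In a lattice, a unit square whose upper left and lower right corners are present has all four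
  corners.
\<close>

definition lattice_cells :: "(int \<times> int) set \<Rightarrow> (int \<times> int) set" where
  "lattice_cells L = {(i, j). (i, j + 1) \<in> L \<and> (i + 1, j) \<in> L}"

text \<open>\<open>column_edge\<close> is the trace that connectedness leaves on the vertices.
  Without it the two points \<open>(0, 0)\<close> and \<open>(1, 1)\<close> would qualify, although
  no vertex lies on the antidiagonal between them.\<close>

locale planar_lattice =
  fixes L :: "(int \<times> int) set"
  assumes finite_L: "finite L"
    and inf_closed: "u \<in> L \<Longrightarrow> v \<in> L \<Longrightarrow> inf u v \<in> L"
    and sup_closed: "u \<in> L \<Longrightarrow> v \<in> L \<Longrightarrow> sup u v \<in> L"
    and horiz_convex: "(i, j) \<in> L \<Longrightarrow> (i', j) \<in> L \<Longrightarrow> i \<le> x \<Longrightarrow> x \<le> i' \<Longrightarrow> (x, j) \<in> L"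
    and vert_convex: "(i, j) \<in> L \<Longrightarrow> (i, j') \<in> L \<Longrightarrow> j \<le> y \<Longrightarrow> y \<le> j' \<Longrightarrow> (i, y) \<in> L"
    and column_edge: "(i, j) \<in> L \<Longrightarrow> (i', j') \<in> L \<Longrightarrow> i < i' \<Longrightarrow> \<exists>y. (i, y) \<in> L \<and> (i + 1, y) \<in> L"
begin

text \<open>Makes the antidiagonal count available inside every interval, in particular for the
  vertices above or below a given one.\<close>

lemma interval:
  assumes "u \<in> L" "v \<in> L"
  shows "planar_lattice {w \<in> L. u \<le> w \<and> w \<le> v}"
proof
  show "finite {w \<in> L. u \<le> w \<and> w \<le> v}" using finite_L by simp
  show "inf x y \<in> {w \<in> L. u \<le> w \<and> w \<le> v}"
    if "x \<in> {w \<in> L. u \<le> w \<and> w \<le> v}" "y \<in> {w \<in> L. u \<le> w \<and> w \<le> v}" for x y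
    using that inf_closed by (auto intro: le_infI1)
  show "sup x y \<in> {w \<in> L. u \<le> w \<and> w \<le> v}"
    if "x \<in> {w \<in> L. u \<le> w \<and> w \<le> v}" "y \<in> {w \<in> L. u \<le> w \<and> w \<le> v}" for x y
    using that sup_closed by (auto intro: le_supI1)
next
  fix i j i' x
  assume "(i, j) \<in> {w \<in> L. u \<le> w \<and> w \<le> v}" "(i', j) \<in> {w \<in> L. u \<le> w \<and> w \<le> v}" "i \<le> x" "x \<le> i'"
  then show "(x, j) \<in> {w \<in> L. u \<le> w \<and> w \<le> v}"
    using horiz_convex[of i j i' x] by (auto simp: less_eq_prod_def)
next
  fix i j j' y
  assume "(i, j) \<in> {w \<in> L. u \<le> w \<and> w \<le> v}" "(i, j') \<in> {w \<in> L. u \<le> w \<and> w \<le> v}" "j \<le> y" "y \<le> j'"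
  then show "(i, y) \<in> {w \<in> L. u \<le> w \<and> w \<le> v}"
    using vert_convex[of i j j' y] by (auto simp: less_eq_prod_def)
next
  fix i j i' j' :: int
  assume *: "(i, j) \<in> {w \<in> L. u \<le> w \<and> w \<le> v}" "(i', j') \<in> {w \<in> L. u \<le> w \<and> w \<le> v}" "i < i'"
  then obtain y where y: "(i, y) \<in> L" "(i + 1, y) \<in> L"
    using column_edge[of i j i' j'] by auto
  \<comment> \<open>The edge over column \<open>i\<close> may lie outside the interval. Joining both
    of its ends with \<open>u\<close> and meeting them with \<open>v\<close> clamps the height and
    keeps the columns.\<close>
  define z where "z = min (max y (snd u)) (snd v)"
  have uv: "fst u \<le> i" "i + 1 \<le> fst v" "snd u \<le> snd v"
    using * by (auto simp: less_eq_prod_def)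
  have "inf (sup (i, y) u) v = (i, z)" "inf (sup (i + 1, y) u) v = (i + 1, z)"
    using uv by (auto simp: z_def inf_prod_def sup_prod_def inf_min sup_max)
  then have "(i, z) \<in> L" "(i + 1, z) \<in> L"
    using y assms inf_closed sup_closed by metis+
  then show "\<exists>y. (i, y) \<in> {w \<in> L. u \<le> w \<and> w \<le> v} \<and> (i + 1, y) \<in> {w \<in> L. u \<le> w \<and> w \<le> v}"
    using uv by (intro exI[of _ z]) (auto simp: less_eq_prod_def z_def)
qed

section \<open>The rank function and saturated chains\<close>

text \<open>An edge from column \<open>i\<close> to column \<open>i + 1\<close> that lies no higher
  than \<open>u\<close> is joined with \<open>u\<close> to give the step to the right. If it lies
  higher, convexity of the column gives the step up, which stays below \<open>v\<close> unless
  \<open>u\<close> and \<open>v\<close> share a row; in that case the row supplies the step to the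
  right.\<close>

lemma covering_step:
  assumes "u \<in> L" "v \<in> L" "u < v"
  shows "\<exists>w\<in>L. u < w \<and> w \<le> v \<and> coord_sum w = coord_sum u + 1"
proof -
  obtain i j where u: "u = (i, j)" by force
  obtain i' j' where v: "v = (i', j')" by force
  have le: "i \<le> i'" "j \<le> j'" "i < i' \<or> j < j'"
    using assms(3) u v by (auto simp: less_le_not_le less_eq_prod_def)
  have "(i < i' \<and> (i + 1, j) \<in> L) \<or> (j < j' \<and> (i, j + 1) \<in> L)"
  proof (cases "i < i'")
    case True
    then obtain y where y: "(i, y) \<in> L" "(i + 1, y) \<in> L"
      using column_edge[of i j i' j'] assms u v by auto
    show ?thesis
    proof (cases "y \<le> j")
      case True
      then have "sup (i, j) (i + 1, y) = (i + 1, j)" by (auto simp: sup_prod_def sup_max)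
      then have "(i + 1, j) \<in> L" using sup_closed[OF assms(1) y(2)] u by simp
      then show ?thesis using \<open>i < i'\<close> by simp
    next
      case False
      then have "(i, j + 1) \<in> L" using vert_convex[of i j y "j + 1"] assms(1) y u by auto
      moreover have "(i + 1, j) \<in> L" if "j = j'"
        using that horiz_convex[of i j i' "i + 1"] assms u v True by auto
      ultimately show ?thesis using le True by fastforce
    qed
  next
    case False
    then have "(i, j + 1) \<in> L" using vert_convex[of i j j' "j + 1"] assms u v le by auto
    then show ?thesis using le False by auto
  qed
  then show ?thesis
  proof
    assume "i < i' \<and> (i + 1, j) \<in> L"
    then show ?thesis
      using le u v by (intro bexI[of _ "(i + 1, j)"]) (auto simp: coord_sum_def less_le_not_le less_eq_prod_def)
  next
    assume "j < j' \<and> (i, j + 1) \<in> L"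
    then show ?thesis
      using le u v by (intro bexI[of _ "(i, j + 1)"]) (auto simp: coord_sum_def less_le_not_le less_eq_prod_def)
  qed
qed

text \<open>That no rank is skipped is used twice: it puts a vertex on every antidiagonal between
  the bounds, and it provides a chain of the maximal size.\<close>

lemma saturated_chain:
  assumes "u \<in> L" "v \<in> L" "u \<le> v"
  shows "\<exists>C\<subseteq>L. (\<forall>x\<in>C. \<forall>y\<in>C. x \<le> y \<or> y \<le> x) \<and> (\<forall>x\<in>C. u \<le> x \<and> x \<le> v) \<and> coord_sum ` C = {coord_sum u..coord_sum v}"
  using assms
proof (induction "nat (coord_sum v - coord_sum u)" arbitrary: u)
  case 0
  then have "u = v" using coord_sum_strict_mono[of u v] by (auto simp: order_le_less)
  then show ?case using 0 by (intro exI[of _ "{u}"]) auto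
next
  case (Suc k)
  then have "u < v" by (cases "u = v") auto
  then obtain w where w: "w \<in> L" "u < w" "w \<le> v" "coord_sum w = coord_sum u + 1"
    using covering_step Suc.prems by blast
  then obtain C where C: "C \<subseteq> L" "\<forall>x\<in>C. \<forall>y\<in>C. x \<le> y \<or> y \<le> x" "\<forall>x\<in>C. w \<le> x \<and> x \<le> v" "coord_sum ` C = {coord_sum w..coord_sum v}"
    using Suc.hyps(1)[of w, OF _ w(1) Suc.prems(2) w(3)] Suc.hyps(2) w(4) by force
  have "{coord_sum u..coord_sum v} = insert (coord_sum u) {coord_sum w..coord_sum v}"
    using w coord_sum_mono[OF w(3)] by auto
  then have "coord_sum ` insert u C = {coord_sum u..coord_sum v}" using C(4) by simp
  moreover have above: "u \<le> x" if "x \<in> C" for x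
    using C(3) that less_imp_le[OF w(2)] order.trans by blast
  moreover have "\<forall>x\<in>insert u C. \<forall>y\<in>insert u C. x \<le> y \<or> y \<le> x"
    using C(2) above by blast
  ultimately show ?case
    using C Suc.prems by (intro exI[of _ "insert u C"]) auto
qed

section \<open>Counting vertices against cells\<close>

text \<open>Meet and join complete the two points to the four corners of a square, and convexity
  fills the square.\<close>

lemma antidiagonal_interval:
  assumes "(x, r - x) \<in> L" "(z, r - z) \<in> L" "x \<le> y" "y \<le> z"
  shows "(y, r - y) \<in> L"
proof -
  have "inf (x, r - x) (z, r - z) = (x, r - z)" "sup (x, r - x) (z, r - z) = (z, r - x)"
    using assms by (auto simp: inf_prod_def sup_prod_def inf_min sup_max)
  then have "(x, r - z) \<in> L" "(z, r - x) \<in> L"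
    using inf_closed sup_closed assms by metis+
  then have "(y, r - z) \<in> L" "(y, r - x) \<in> L"
    using horiz_convex assms by blast+
  then show ?thesis using vert_convex[of y "r - z" "r - x" "r - y"] assms by simp
qed

lemma card_antidiagonal:
  assumes "u \<in> L" "coord_sum u = r"
  shows "card {v \<in> L. coord_sum v = r} = card {c \<in> lattice_cells L. coord_sum c + 1 = r} + 1"
proof -
  define A where "A = {x. (x, r - x) \<in> L}"
  have LA: "{v \<in> L. coord_sum v = r} = (\<lambda>x. (x, r - x)) ` A"
    by (force simp: A_def coord_sum_def)
  have inj: "inj_on (\<lambda>x. (x, s - x)) B" for s :: int and B by (auto simp: inj_on_def)
  have finA: "finite A"
    using finite_imageD[OF _ inj, of r A] finite_L LA[symmetric] by simp
  have neA: "A \<noteq> {}" using assms LA by auto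
  define a where "a = Min A"
  define b where "b = Max A"
  have "a \<in> A" "b \<in> A" "a \<le> b" and ab: "\<And>x. x \<in> A \<Longrightarrow> a \<le> x \<and> x \<le> b"
    using finA neA by (auto simp: a_def b_def)
  have A: "A = {a..b}"
  proof (intro equalityI subsetI)
    fix x assume "x \<in> {a..b}"
    then show "x \<in> A"
      using antidiagonal_interval[of a r b x] \<open>a \<in> A\<close> \<open>b \<in> A\<close> unfolding A_def by simp
  qed (use ab in simp)
  \<comment> \<open>The upper left and lower right corners of a cell \<open>c\<close> have rank
    \<open>coord_sum c + 1\<close>. They are the neighbours \<open>x\<close> and
    \<open>x + 1\<close> on the antidiagonal \<open>r\<close>, so the cell is recorded by
    \<open>x\<close>.\<close>
  have "{c \<in> lattice_cells L. coord_sum c + 1 = r} = (\<lambda>x. (x, (r - 1) - x)) ` {x \<in> A. x + 1 \<in> A}"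
  proof -
    have "(x, y) \<in> lattice_cells L \<and> coord_sum (x, y) + 1 = r \<longleftrightarrow> y = (r - 1) - x \<and> x \<in> A \<and> x + 1 \<in> A" for x y
    proof -
      have eq: "r - x = (r - 1 - x) + 1" "r - (x + 1) = r - 1 - x" by auto
      show ?thesis
        unfolding A_def mem_Collect_eq eq by (auto simp: lattice_cells_def coord_sum_def)
    qed
    then show ?thesis by auto
  qed
  moreover have "{x \<in> A. x + 1 \<in> A} = {a..b - 1}"
    unfolding A by auto
  ultimately have "card {c \<in> lattice_cells L. coord_sum c + 1 = r} = nat (b - a)"
    by (simp add: card_image[OF inj])
  moreover have "card {v \<in> L. coord_sum v = r} = nat (b - a + 1)"
    unfolding LA card_image[OF inj] A by simp
  ultimately show ?thesis using \<open>a \<le> b\<close> by simp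
qed

lemma finite_cells: "finite (lattice_cells L)"
proof -
  have "lattice_cells L \<subseteq> (\<lambda>(i, j). (i, j - 1)) ` L"
    by (force simp: lattice_cells_def)
  then show ?thesis using finite_L finite_surj by blast
qed

lemma cell_corners:
  assumes "c \<in> lattice_cells L"
  shows "c \<in> L" "c + (1, 1) \<in> L"
proof -
  obtain i j where c: "c = (i, j)" by force
  then have *: "(i, j + 1) \<in> L" "(i + 1, j) \<in> L" using assms by (auto simp: lattice_cells_def)
  have "inf (i, j + 1) (i + 1, j) = (i, j)" "sup (i, j + 1) (i + 1, j) = (i + 1, j + 1)"
    by (auto simp: inf_prod_def sup_prod_def inf_min sup_max)
  then show "c \<in> L" "c + (1, 1) \<in> L"
    using inf_closed[OF *] sup_closed[OF *] c by auto
qed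

text \<open>Weighted form of the count: every rank from \<open>b\<close> to \<open>t\<close> is
  attained, so each contributes one surplus vertex. The weight \<open>1\<close> yields
  cardinalities; a linear weight converts sums of ranks over cells into sums over vertices.\<close>

lemma sum_over_antidiagonals:
  fixes f :: "int \<Rightarrow> int"
  assumes "b \<in> L" "t \<in> L" "\<And>v. v \<in> L \<Longrightarrow> b \<le> v \<and> v \<le> t"
  shows "(\<Sum>v\<in>L. f (coord_sum v)) = (\<Sum>c\<in>lattice_cells L. f (coord_sum c + 1)) + (\<Sum>r\<in>{coord_sum b..coord_sum t}. f r)"
proof -
  let ?R = "{coord_sum b..coord_sum t}"
  have "coord_sum v \<in> ?R" if "v \<in> L" for v using assms(3)[OF that] coord_sum_mono by auto
  then have R1: "coord_sum ` L \<subseteq> ?R" by auto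
  have "coord_sum c + 1 \<in> ?R" if "c \<in> lattice_cells L" for c
    using cell_corners[OF that] assms(3) coord_sum_mono[of b c] coord_sum_mono[of "c + (1,1)" t] by (auto simp: coord_sum_def)
  then have R2: "(\<lambda>c. coord_sum c + 1) ` lattice_cells L \<subseteq> ?R" by auto
  have ex: "\<exists>u\<in>L. coord_sum u = r" if "r \<in> ?R" for r
    using saturated_chain[of b t] assms that by (metis imageE subsetD)
  have "(\<Sum>v\<in>L. f (coord_sum v)) = (\<Sum>r\<in>?R. \<Sum>v\<in>{v\<in>L. coord_sum v = r}. f (coord_sum v))"
    using sum.group[OF finite_L _ R1, of "\<lambda>v. f (coord_sum v)"] by simp
  also have "\<dots> = (\<Sum>r\<in>?R. int (card {v\<in>L. coord_sum v = r}) * f r)"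
    by (intro sum.cong) auto
  also have "\<dots> = (\<Sum>r\<in>?R. int (card {c \<in> lattice_cells L. coord_sum c + 1 = r}) * f r + f r)"
  proof (intro sum.cong refl)
    fix r assume "r \<in> ?R"
    then obtain u where "u \<in> L" "coord_sum u = r" using ex by blast
    then show "int (card {v \<in> L. coord_sum v = r}) * f r = int (card {c \<in> lattice_cells L. coord_sum c + 1 = r}) * f r + f r"
      using card_antidiagonal by (simp add: algebra_simps)
  qed
  also have "\<dots> = (\<Sum>r\<in>?R. int (card {c \<in> lattice_cells L. coord_sum c + 1 = r}) * f r) + (\<Sum>r\<in>?R. f r)"
    by (simp add: sum.distrib)
  also have "(\<Sum>r\<in>?R. int (card {c \<in> lattice_cells L. coord_sum c + 1 = r}) * f r)
      = (\<Sum>r\<in>?R. \<Sum>c\<in>{c \<in> lattice_cells L. coord_sum c + 1 = r}. f (coord_sum c + 1))"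
    by (intro sum.cong) auto
  also have "\<dots> = (\<Sum>c\<in>lattice_cells L. f (coord_sum c + 1))"
    using sum.group[OF finite_cells _ R2, of "\<lambda>c. f (coord_sum c + 1)"] by simp
  finally show ?thesis .
qed

lemma card_interval:
  assumes "u \<in> L" "v \<in> L" "u \<le> v"
  shows "int (card {w \<in> L. u \<le> w \<and> w \<le> v}) =
    int (card {c \<in> lattice_cells L. u \<le> c \<and> c + (1, 1) \<le> v}) + (coord_sum v - coord_sum u + 1)"
proof -
  interpret M: planar_lattice "{w \<in> L. u \<le> w \<and> w \<le> v}" using interval[OF assms(1,2)] .
  have "lattice_cells {w \<in> L. u \<le> w \<and> w \<le> v} = {c \<in> lattice_cells L. u \<le> c \<and> c + (1, 1) \<le> v}"
  proof -
    obtain u1 u2 v1 v2 where "u = (u1, u2)" "v = (v1, v2)" by force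
    then show ?thesis by (auto simp: lattice_cells_def)
  qed
  then have cells: "int (card (lattice_cells {w \<in> L. u \<le> w \<and> w \<le> v}))
      = int (card {c \<in> lattice_cells L. u \<le> c \<and> c + (1, 1) \<le> v})"
    by (rule arg_cong)
  have "(\<Sum>w\<in>{w \<in> L. u \<le> w \<and> w \<le> v}. 1::int) =
      (\<Sum>c\<in>lattice_cells {w \<in> L. u \<le> w \<and> w \<le> v}. 1) + (\<Sum>r\<in>{coord_sum u..coord_sum v}. 1)"
    using assms by (intro M.sum_over_antidiagonals[of u v "\<lambda>_. 1"]) blast+
  then have "int (card {w \<in> L. u \<le> w \<and> w \<le> v}) =
      int (card (lattice_cells {w \<in> L. u \<le> w \<and> w \<le> v})) + int (nat (coord_sum v - coord_sum u + 1))"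
    unfolding sum_constant by simp
  then show ?thesis using cells coord_sum_mono[OF assms(3)] by linarith
qed

text \<open>For each \<open>u\<close> count the cells above it and the ranks above it. Summed over
  \<open>u\<close>, the cells become pairs of a cell \<open>c\<close> and a vertex below
  \<open>c\<close>, and \<open>card_interval\<close> turns those vertices into cells plus ranks
  again. The distances of a vertex from \<open>b\<close> and to \<open>t\<close> add up to
  \<open>D\<close>, which gives \<open>D * card L\<close>; the surplus of one vertex per rank leaves
  the triangular number of \<open>D\<close>. Doubling avoids a division.\<close>

lemma card_comparable_pairs:
  assumes "b \<in> L" "t \<in> L" "\<And>v. v \<in> L \<Longrightarrow> b \<le> v \<and> v \<le> t"
  defines "D \<equiv> coord_sum t - coord_sum b"
  shows "2 * int (card {(u, v) \<in> L \<times> L. u < v}) =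
     2 * D * int (card L) - D * (D + 1)
     + 2 * int (card {(c, c') \<in> lattice_cells L \<times> lattice_cells L. c + (1, 1) \<le> c'})"
proof -
  let ?C = "lattice_cells L"
  let ?S = "{(c, c') \<in> ?C \<times> ?C. c + (1, 1) \<le> c'}"
  have D0: "D \<ge> 0" unfolding D_def using assms(1,3) coord_sum_mono by simp
  have up: "int (card {v \<in> L. u \<le> v}) = int (card {c \<in> ?C. u \<le> c}) + (coord_sum t - coord_sum u + 1)" if "u \<in> L" for u
  proof -
    have "{v \<in> L. u \<le> v} = {v \<in> L. u \<le> v \<and> v \<le> t}" using assms(3) by auto
    moreover have "{c \<in> ?C. u \<le> c} = {c \<in> ?C. u \<le> c \<and> c + (1, 1) \<le> t}"
      using assms(3) cell_corners by auto
    ultimately show ?thesis using card_interval[OF that assms(2)] assms(3)[OF that] by simp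
  qed
  have down: "int (card {u \<in> L. u \<le> c}) = int (card {c' \<in> ?C. c' + (1, 1) \<le> c}) + (coord_sum c - coord_sum b + 1)" if "c \<in> L" for c
  proof -
    have "{v \<in> L. v \<le> c} = {v \<in> L. b \<le> v \<and> v \<le> c}" using assms(3) by auto
    moreover have "{c' \<in> ?C. c' + (1, 1) \<le> c} = {c' \<in> ?C. b \<le> c' \<and> c' + (1, 1) \<le> c}"
      using assms(3) cell_corners by auto
    ultimately show ?thesis using card_interval[OF assms(1) that] assms(3)[OF that] by simp
  qed
  have card_L: "int (card L) = int (card ?C) + (D + 1)"
    using sum_over_antidiagonals[OF assms(1-3), of "\<lambda>_. 1"] D0 by (simp add: D_def)
  have "int (card {(u, v) \<in> L \<times> L. u < v}) = (\<Sum>u\<in>L. int (card {v \<in> L. u < v}))"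
  proof -
    have "{(u, v) \<in> L \<times> L. u < v} = (SIGMA u:L. {v \<in> L. u < v})" by auto
    then show ?thesis using finite_L by simp
  qed
  also have "\<dots> = (\<Sum>u\<in>L. int (card {c \<in> ?C. u \<le> c}) + (coord_sum t - coord_sum u))"
  proof (intro sum.cong refl)
    fix u assume u: "u \<in> L"
    have "{v \<in> L. u \<le> v} = insert u {v \<in> L. u < v}" using u by auto
    then show "int (card {v \<in> L. u < v}) = int (card {c \<in> ?C. u \<le> c}) + (coord_sum t - coord_sum u)"
      using up[OF u] finite_L by simp
  qed
  also have "\<dots> = (\<Sum>u\<in>L. int (card {c \<in> ?C. u \<le> c})) + (\<Sum>u\<in>L. coord_sum t - coord_sum u)"
    by (simp add: sum.distrib)
  also have "(\<Sum>u\<in>L. int (card {c \<in> ?C. u \<le> c})) = (\<Sum>c\<in>?C. int (card {u \<in> L. u \<le> c}))"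
    using sum.swap_restrict[OF finite_L finite_cells, of "\<lambda>_ _. 1::int" "(\<le>)"] by simp
  also have "\<dots> = (\<Sum>c\<in>?C. int (card {c' \<in> ?C. c' + (1, 1) \<le> c}) + (coord_sum c - coord_sum b + 1))"
    using down cell_corners by (intro sum.cong) auto
  also have "\<dots> = (\<Sum>c\<in>?C. int (card {c' \<in> ?C. c' + (1, 1) \<le> c})) + (\<Sum>c\<in>?C. coord_sum c - coord_sum b + 1)"
    by (simp add: sum.distrib)
  also have "(\<Sum>c\<in>?C. int (card {c' \<in> ?C. c' + (1, 1) \<le> c})) = (\<Sum>c\<in>?C. int (card {c' \<in> ?C. c + (1, 1) \<le> c'}))"
    using sum.swap_restrict[OF finite_cells finite_cells, of "\<lambda>_ _. 1::int" "\<lambda>c c'. c' + (1, 1) \<le> c"] by simp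
  also have "\<dots> = int (card ?S)"
  proof -
    have "?S = (SIGMA c:?C. {c' \<in> ?C. c + (1, 1) \<le> c'})" by auto
    then show ?thesis using finite_cells by simp
  qed
  also have "(\<Sum>c\<in>?C. coord_sum c - coord_sum b + 1) = (\<Sum>u\<in>L. coord_sum u - coord_sum b) - (\<Sum>r\<in>{coord_sum b..coord_sum t}. r - coord_sum b)"
    using sum_over_antidiagonals[OF assms(1-3), of "\<lambda>r. r - coord_sum b"] by (simp add: algebra_simps)
  finally have "int (card {(u, v) \<in> L \<times> L. u < v}) = int (card ?S)
      + ((\<Sum>u\<in>L. coord_sum u - coord_sum b) + (\<Sum>u\<in>L. coord_sum t - coord_sum u)) - (\<Sum>r\<in>{coord_sum b..coord_sum t}. r - coord_sum b)"
    by simp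
  also have "(\<Sum>u\<in>L. coord_sum u - coord_sum b) + (\<Sum>u\<in>L. coord_sum t - coord_sum u) = D * int (card L)"
    by (simp add: sum.distrib[symmetric] D_def)
  also have "(\<Sum>r\<in>{coord_sum b..coord_sum t}. r - coord_sum b) = (\<Sum>k\<le>nat D. int k)"
    by (rule sum.reindex_bij_witness[of _ "\<lambda>k. int k + coord_sum b" "\<lambda>r. nat (r - coord_sum b)"])
       (use D0 in \<open>auto simp: D_def\<close>)
  finally have *: "int (card {(u, v) \<in> L \<times> L. u < v}) = int (card ?S) + D * int (card L) - (\<Sum>k\<le>nat D. int k)" .
  have "2 * (\<Sum>k\<le>m. int k) = int m * (int m + 1)" for m
    by (induction m) (auto simp: algebra_simps)
  from this[of "nat D"] have "2 * (\<Sum>k\<le>nat D. int k) = D * (D + 1)" using D0 by simp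
  with * show ?thesis by (simp add: algebra_simps)
qed

end

section \<open>Convex polyominoes\<close>

definition integer_points :: "(real \<times> real) set \<Rightarrow> (int \<times> int) set" where
  "integer_points X = {(a, b). (real_of_int a, real_of_int b) \<in> X}"

lemma vertex_set_eq: "vertex_set X = (\<lambda>(a, b). (real_of_int a, real_of_int b)) ` integer_points X"
  by (force simp: vertex_set_def integer_points_def Ints_def)

lemma mem_horizontal_segment:
  assumes "(a::real) \<le> x" "x \<le> b"
  shows "(x, y) \<in> closed_segment (a, y::real) (b, y)"
proof -
  have "x \<in> closed_segment a b" using assms by (auto simp: closed_segment_eq_real_ivl)
  then obtain u where "0 \<le> u" "u \<le> 1" "x = (1 - u) * a + u * b" by (auto simp: closed_segment_def)
  then show ?thesis by (auto simp: closed_segment_def algebra_simps intro!: exI[of _ u])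
qed

lemma mem_vertical_segment:
  assumes "(a::real) \<le> y" "y \<le> b"
  shows "(x, y) \<in> closed_segment (x::real, a) (x, b)"
proof -
  have "y \<in> closed_segment a b" using assms by (auto simp: closed_segment_eq_real_ivl)
  then obtain u where "0 \<le> u" "u \<le> 1" "y = (1 - u) * a + u * b" by (auto simp: closed_segment_def)
  then show ?thesis by (auto simp: closed_segment_def algebra_simps intro!: exI[of _ u])
qed

lemma horizontally_convexD:
  "horizontally_convex X \<Longrightarrow> (a, y) \<in> X \<Longrightarrow> (b, y) \<in> X \<Longrightarrow> a \<le> x \<Longrightarrow> x \<le> b \<Longrightarrow> (x, y) \<in> X"
  unfolding horizontally_convex_def using mem_horizontal_segment by (metis snd_conv subsetD)

lemma vertically_convexD:
  "vertically_convex X \<Longrightarrow> (x, a) \<in> X \<Longrightarrow> (x, b) \<in> X \<Longrightarrow> a \<le> y \<Longrightarrow> y \<le> b \<Longrightarrow> (x, y) \<in> X"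
  unfolding vertically_convex_def using mem_vertical_segment by (metis fst_conv subsetD)

lemma planar_lattice_integer_points:
  assumes X: "convex_polyomino X" and V: "sublattice_of_N2 (vertex_set X)"
  shows "planar_lattice (integer_points X)"
proof -
  obtain C where C: "finite C" "X = (\<Union>c\<in>C. unit_cell c)" and conn: "connected X"
    and hc: "horizontally_convex X" and vc: "vertically_convex X"
    using X by (auto simp: convex_polyomino_def polyomino_def)
  let ?L = "integer_points X"
  have V': "inf u v \<in> vertex_set X" "sup u v \<in> vertex_set X" if "u \<in> vertex_set X" "v \<in> vertex_set X" for u v
    using V that by (auto simp: sublattice_of_N2_def)
  have mem: "(a, b) \<in> ?L \<longleftrightarrow> (real_of_int a, real_of_int b) \<in> vertex_set X" for a b
    by (auto simp: integer_points_def vertex_set_def)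
  show ?thesis
  proof
    have "?L \<subseteq> (\<Union>(i, j)\<in>C. {i..i + 1} \<times> {j..j + 1})"
    proof
      fix p assume "p \<in> ?L"
      then obtain a b c where p: "p = (a, b)" "c \<in> C" "(real_of_int a, real_of_int b) \<in> unit_cell c"
        using C(2) by (auto simp: integer_points_def)
      obtain i j where c: "c = (i, j)" by force
      have "i \<le> a" "a \<le> i + 1" "j \<le> b" "b \<le> j + 1" using p(3) c by (auto simp: unit_cell_def)
      then show "p \<in> (\<Union>(i, j)\<in>C. {i..i + 1} \<times> {j..j + 1})"
        using p(1,2) c by (intro UN_I[of c]) simp_all
    qed
    then show "finite ?L" by (rule finite_subset) (use C(1) in auto)
  next
    fix u v assume uv: "u \<in> ?L" "v \<in> ?L"
    obtain a b c d where eq: "u = (a, b)" "v = (c, d)" by force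
    have *: "(real_of_int a, real_of_int b) \<in> vertex_set X" "(real_of_int c, real_of_int d) \<in> vertex_set X"
      using uv eq mem by auto
    show "inf u v \<in> ?L" using V'(1)[OF *] mem[of "min a c" "min b d"] eq
      by (simp add: inf_prod_def inf_min of_int_min)
    show "sup u v \<in> ?L" using V'(2)[OF *] mem[of "max a c" "max b d"] eq
      by (simp add: sup_prod_def sup_max of_int_max)
  next
    fix i j i' x assume "(i, j) \<in> ?L" "(i', j) \<in> ?L" "i \<le> x" "x \<le> i'"
    then show "(x, j) \<in> ?L" 
      using horizontally_convexD[OF hc, of "real_of_int i" "real_of_int j" "real_of_int i'" "real_of_int x"]
      by (simp add: integer_points_def)
  next
    fix i j j' y assume "(i, j) \<in> ?L" "(i, j') \<in> ?L" "j \<le> y" "y \<le> j'"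
    then show "(i, y) \<in> ?L" 
      using vertically_convexD[OF vc, of "real_of_int i" "real_of_int j" "real_of_int j'" "real_of_int y"]
      by (simp add: integer_points_def)
  next
    fix i j i' j' assume ij: "(i, j) \<in> ?L" "(i', j') \<in> ?L" "i < i'"
    have "connected (fst ` X)"
      by (intro connected_continuous_image conn continuous_intros)
    moreover have "real_of_int i \<in> fst ` X" "real_of_int i' \<in> fst ` X"
      using ij by (force simp: integer_points_def)+
    \<comment> \<open>The midpoint matters: a cell meeting the line over \<open>i + 1/2\<close> must
      lie in column \<open>i\<close>, whereas one meeting the line over \<open>i\<close> could also
      lie in column \<open>i - 1\<close>.\<close>
    moreover have "real_of_int i + 1/2 \<le> real_of_int i'" using ij(3) by linarith
    ultimately have "real_of_int i + 1/2 \<in> fst ` X"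
      unfolding connected_iff_interval by force
    then obtain s c where c: "c \<in> C" "(real_of_int i + 1/2, s) \<in> unit_cell c" using C(2) by force
    obtain a b where ab: "c = (a, b)" by force
    have "real_of_int a \<le> real_of_int i + 1/2" "real_of_int i + 1/2 \<le> real_of_int a + 1"
      using c(2) ab by (auto simp: unit_cell_def)
    then have "a = i" by linarith
    then have "unit_cell (i, b) \<subseteq> X" using c(1) ab C(2) by auto
    moreover have "(real_of_int i, real_of_int b) \<in> unit_cell (i, b)"
      "(real_of_int i + 1, real_of_int b) \<in> unit_cell (i, b)"
      by (simp_all add: unit_cell_def)
    ultimately have "(i, b) \<in> ?L \<and> (i + 1, b) \<in> ?L"
      by (auto simp: integer_points_def)
    then show "\<exists>y. (i, y) \<in> ?L \<and> (i + 1, y) \<in> ?L" by blast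
  qed
qed

text \<open>The lattice property supplies all four corners, horizontal convexity the two horizontal
  sides, and vertical convexity everything between them.\<close>

lemma cells_eq:
  assumes X: "convex_polyomino X" and V: "sublattice_of_N2 (vertex_set X)"
  shows "cells X = lattice_cells (integer_points X)"
proof -
  interpret planar_lattice "integer_points X" using planar_lattice_integer_points[OF assms] .
  have hc: "horizontally_convex X" and vc: "vertically_convex X"
    using X by (auto simp: convex_polyomino_def)
  show ?thesis
  proof (intro equalityI subsetI)
    fix c assume c: "c \<in> cells X"
    obtain i j where "c = (i, j)" by force
    then show "c \<in> lattice_cells (integer_points X)"
      using c by (auto simp: cells_def unit_cell_def lattice_cells_def integer_points_def)
  next
    fix c assume c: "c \<in> lattice_cells (integer_points X)"
    obtain i j where ij: "c = (i, j)" by force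
    have corners: "(real_of_int i, real_of_int j) \<in> X" "(real_of_int i + 1, real_of_int j) \<in> X"
      "(real_of_int i, real_of_int j + 1) \<in> X" "(real_of_int i + 1, real_of_int j + 1) \<in> X"
      using c cell_corners[OF c] ij by (auto simp: lattice_cells_def integer_points_def)
    have "(x, y) \<in> X" if "real_of_int i \<le> x" "x \<le> real_of_int i + 1" "real_of_int j \<le> y" "y \<le> real_of_int j + 1" for x y
      using horizontally_convexD[OF hc corners(1,2) that(1,2)] horizontally_convexD[OF hc corners(3,4) that(1,2)]
        vertically_convexD[OF vc] that(3,4) by blast
    then show "c \<in> cells X" by (auto simp: cells_def unit_cell_def ij)
  qed
qed

section \<open>Pairs of rooks\<close>

lemma rook_number_2_gt:
  assumes X: "convex_polyomino X" and V: "sublattice_of_N2 (vertex_set X)" and "\<not> thin X"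
  shows "card {(c, c') \<in> cells X \<times> cells X. c + (1, 1) \<le> c'} < rook_number X 2"
proof -
  interpret planar_lattice "integer_points X" using planar_lattice_integer_points[OF X V] .
  let ?S = "{(c, c') \<in> cells X \<times> cells X. c + (1, 1) \<le> c'}"
  let ?f = "\<lambda>(c, c'). {c, c'} :: (int \<times> int) set"
  have fin: "finite (cells X)" using finite_cells cells_eq[OF X V] by simp
  obtain a b where ab: "{(a, b), (a + 1, b), (a, b + 1), (a + 1, b + 1)} \<subseteq> cells X"
    using assms(3) unfolding thin_def by blast
  let ?e = "{(a + 1, b), (a, b + 1)}"
  \<comment> \<open>The relation between \<open>c\<close> and \<open>c'\<close> is asymmetric, so
    the unordered pair determines the ordered one.\<close>
  have "inj_on ?f ?S"
    by (auto simp: inj_on_def doubleton_eq_iff less_eq_prod_def)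
  then have card: "card (?f ` ?S) = card ?S" by (rule card_image)
  have "?e \<notin> ?f ` ?S" by (auto simp: doubleton_eq_iff less_eq_prod_def)
  moreover have "?f ` ?S \<subseteq> rook_configurations X 2"
  proof clarify
    fix i j i' j' assume "(i, j) \<in> cells X" "(i', j') \<in> cells X" and le: "(i, j) + (1, 1) \<le> (i', j')"
    moreover have "i < i'" "j < j'" using le by auto
    ultimately show "{(i, j), (i', j')} \<in> rook_configurations X 2"
      by (auto simp: rook_configurations_def)
  qed
  moreover have "?e \<in> rook_configurations X 2"
    using ab by (auto simp: rook_configurations_def)
  moreover have "finite (rook_configurations X 2)"
    by (rule finite_subset[of _ "Pow (cells X)"]) (use fin in \<open>auto simp: rook_configurations_def\<close>)
  ultimately have "card (insert ?e (?f ` ?S)) \<le> rook_number X 2"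
    unfolding rook_number_def by (intro card_mono) auto
  moreover have "finite (?f ` ?S)"
    by (intro finite_imageI finite_subset[of ?S "cells X \<times> cells X"]) (use fin in auto)
  ultimately show ?thesis using card \<open>?e \<notin> ?f ` ?S\<close> by simp
qed

text \<open>The defining sum stops at \<open>card (cells X)\<close>; the existence of a 2-rook
  configuration shows that the index 2 lies in its range.\<close>

lemma coeff_rook_polynomial_2:
  assumes "finite (cells X)" "rook_number X 2 > 0"
  shows "poly.coeff (rook_polynomial X) 2 = int (rook_number X 2)"
proof -
  have "\<exists>S. S \<in> rook_configurations X 2"
    using assms unfolding rook_number_def by (metis card.empty ex_in_conv less_irrefl)
  then obtain S where S: "S \<subseteq> cells X" "card S = 2" by (auto simp: rook_configurations_def)
  have "poly.coeff (rook_polynomial X) 2 = (\<Sum>k\<le>card (cells X). if k = 2 then int (rook_number X k) else 0)"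
    unfolding rook_polynomial_def by (simp add: coeff_sum)
  also have "\<dots> = (if 2 \<le> card (cells X) then int (rook_number X 2) else 0)"
    by (subst sum.delta) auto
  finally show ?thesis
    using S card_mono[OF assms(1) S(1)] by simp
qed

abbreviation "lookup \<equiv> Poly_Mapping.lookup"
abbreviation "keys \<equiv> Poly_Mapping.keys"
abbreviation "single \<equiv> Poly_Mapping.single"

section \<open>Polynomial rings\<close>

lemma poly_mapping_sum_singles:
  fixes p :: "'a \<Rightarrow>\<^sub>0 'b::comm_monoid_add"
  assumes "finite A" "keys p \<subseteq> A"
  shows "(\<Sum>m\<in>A. single m (lookup p m)) = p"
proof (rule poly_mapping_eqI)
  fix k
  have "lookup (\<Sum>m\<in>A. single m (lookup p m)) k = (\<Sum>m\<in>A. if m = k then lookup p m else 0)"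
    unfolding lookup_sum by (intro sum.cong) (auto simp: lookup_single when_def)
  also have "\<dots> = lookup p k"
    using assms by (subst sum.delta) (auto simp: in_keys_iff)
  finally show "lookup (\<Sum>m\<in>A. single m (lookup p m)) k = lookup p k" .
qed

lemma keys_add_nat: "keys (m + n) = keys m \<union> keys n" for m n :: "'a \<Rightarrow>\<^sub>0 nat"
  by (auto simp: in_keys_iff lookup_add)

lemma keys_uminus: "keys (- p) = keys p" for p :: "'a \<Rightarrow>\<^sub>0 'b::ab_group_add"
  by (auto simp: in_keys_iff)

lemma keys_minus_subset: "keys (p - q) \<subseteq> keys p \<union> keys q" for p q :: "'a \<Rightarrow>\<^sub>0 'b::ab_group_add"
  by (auto simp: in_keys_iff lookup_minus)

lemma keys_sum_subset: "keys (\<Sum>i\<in>J. f i) \<subseteq> (\<Union>i\<in>J. keys (f i))"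
  for f :: "'i \<Rightarrow> 'a \<Rightarrow>\<^sub>0 'b::comm_monoid_add"
proof (induction J rule: infinite_finite_induct)
  case (insert i J)
  then show ?case using keys_add[of "f i" "sum f J"] by auto
qed auto

lemma split_single:
  assumes "v \<in> keys m"
  obtains r where "m = single v (1::nat) + r"
proof
  show "m = single v 1 + (m - single v 1)"
    using assms by (intro poly_mapping_eqI) (auto simp: lookup_add lookup_minus lookup_single when_def in_keys_iff)
qed

text \<open>Common pattern of the toric exponent and of the potential maximized in the straightening
  argument: when each \<open>f v\<close> is additive, products of monomials become sums.\<close>

definition additive_extension :: "('v \<Rightarrow> nat \<Rightarrow> 'b::comm_monoid_add) \<Rightarrow> ('v \<Rightarrow>\<^sub>0 nat) \<Rightarrow> 'b" where
  "additive_extension f m = (\<Sum>v\<in>keys m. f v (lookup m v))"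

lemma additive_extension_zero: "additive_extension f 0 = 0"
  by (simp add: additive_extension_def)

lemma additive_extension_add:
  assumes "\<And>v. f v 0 = 0" "\<And>v a b. f v (a + b) = f v a + f v b"
  shows "additive_extension f (m + n) = additive_extension f m + additive_extension f n"
  unfolding additive_extension_def by (intro setsum_keys_plus_distrib assms)

lemma additive_extension_single:
  "f v 0 = 0 \<Longrightarrow> additive_extension f (single v k) = f v k"
  by (auto simp: additive_extension_def)

lemma monomial_degree_add: "monomial_degree (m + n) = monomial_degree m + monomial_degree n"
  unfolding monomial_degree_def
  by (rule setsum_keys_plus_distrib[of "\<lambda>_ k. k"]) auto

lemma monomial_degree_single [simp]: "monomial_degree (single v k) = k"
  by (auto simp: monomial_degree_def)

lemma monomial_degree_zero [simp]: "monomial_degree 0 = 0"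
  by (simp add: monomial_degree_def)

lemma monomial_degree_eq_0_iff: "monomial_degree m = 0 \<longleftrightarrow> m = 0"
  by (auto simp: monomial_degree_def in_keys_iff)
     (metis poly_mapping_eqI lookup_zero)

lemma lookup_le_monomial_degree: "lookup m v \<le> monomial_degree m"
  unfolding monomial_degree_def
  by (cases "v \<in> keys m") (auto simp: in_keys_iff intro: member_le_sum)

text \<open>Monomials with support in \<open>V\<close> are treated as functions on \<open>V\<close>,
  so that finiteness and cardinality bounds come from products of finite sets.\<close>

lemma inj_on_restrict_lookup:
  "inj_on (\<lambda>m. restrict (lookup m) V) {m :: 'v \<Rightarrow>\<^sub>0 'b::zero. keys m \<subseteq> V}"
proof (rule inj_onI)
  fix m n :: "'v \<Rightarrow>\<^sub>0 'b"
  assume *: "m \<in> {m. keys m \<subseteq> V}" "n \<in> {m. keys m \<subseteq> V}" and eq: "restrict (lookup m) V = restrict (lookup n) V"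
  show "m = n"
  proof (rule poly_mapping_eqI)
    fix v
    show "lookup m v = lookup n v"
    proof (cases "v \<in> V")
      case True
      then show ?thesis using fun_cong[OF eq, of v] by simp
    next
      case False
      then have "v \<notin> keys m" "v \<notin> keys n" using * by auto
      then show ?thesis by (simp add: in_keys_iff)
    qed
  qed
qed

lemma finite_monomials_le:
  assumes "finite V"
  shows "finite {m :: 'v \<Rightarrow>\<^sub>0 nat. keys m \<subseteq> V \<and> monomial_degree m \<le> n}" (is "finite ?M")
proof (rule finite_imageD)
  have "(\<lambda>m. restrict (lookup m) V) ` ?M \<subseteq> (\<Pi>\<^sub>E v\<in>V. {..n})"
    by (auto intro: order.trans[OF lookup_le_monomial_degree])
  then show "finite ((\<lambda>m. restrict (lookup m) V) ` ?M)"
    by (rule finite_subset) (use assms in \<open>auto intro: finite_PiE\<close>)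
  show "inj_on (\<lambda>m. restrict (lookup m) V) ?M"
    by (rule inj_on_subset[OF inj_on_restrict_lookup]) auto
qed

text \<open>The weight of a monomial is an arbitrary polynomial. The value 0 is allowed, which is
  how a toric map kills variables.\<close>

definition linear_extension :: "(('v \<Rightarrow>\<^sub>0 nat) \<Rightarrow> 'e::comm_monoid_add \<Rightarrow>\<^sub>0 'k) \<Rightarrow> ('v, 'k::field) mpoly \<Rightarrow> 'e \<Rightarrow>\<^sub>0 'k" where
  "linear_extension w p = (\<Sum>m\<in>keys p. single 0 (lookup p m) * w m)"

lemma linear_extension_zero [simp]: "linear_extension w 0 = 0"
  by (simp add: linear_extension_def)

lemma linear_extension_single [simp]: "linear_extension w (single m c) = single 0 c * w m"
  by (auto simp: linear_extension_def)

lemma linear_extension_add: "linear_extension w (p + q) = linear_extension w p + linear_extension w q"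
  unfolding linear_extension_def
  by (rule setsum_keys_plus_distrib[of "\<lambda>m c. single 0 c * w m"]) (auto simp: single_add algebra_simps)

lemma linear_extension_uminus: "linear_extension w (- p) = - linear_extension w p"
  using linear_extension_add[of w p "- p"] by (simp add: minus_unique)

lemma linear_extension_diff: "linear_extension w (p - q) = linear_extension w p - linear_extension w q"
  using linear_extension_add[of w p "- q"] by (simp add: linear_extension_uminus)

lemma linear_extension_sum: "linear_extension w (\<Sum>i\<in>J. f i) = (\<Sum>i\<in>J. linear_extension w (f i))"
  by (induction J rule: infinite_finite_induct) (auto simp: linear_extension_add)

lemma linear_extension_mult:
  assumes w: "\<And>m n. w (m + n) = w m * w n"
  shows "linear_extension w (p * q) = linear_extension w p * linear_extension w q"
proof -
  have "p * q = (\<Sum>m\<in>keys p. single m (lookup p m)) * (\<Sum>n\<in>keys q. single n (lookup q n))"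
    by (simp add: poly_mapping_sum_singles)
  also have "\<dots> = (\<Sum>m\<in>keys p. \<Sum>n\<in>keys q. single (m + n) (lookup p m * lookup q n))"
    by (simp add: sum_product mult_single)
  also have "linear_extension w \<dots> = (\<Sum>m\<in>keys p. \<Sum>n\<in>keys q.
      (single 0 (lookup p m) * w m) * (single 0 (lookup q n) * w n))"
    by (simp add: linear_extension_sum w mult_single[of 0 _ 0, simplified, symmetric] algebra_simps)
  finally show ?thesis by (simp add: linear_extension_def sum_product)
qed

lemma poly_ring_simps [simp]:
  "(\<otimes>\<^bsub>poly_ring V\<^esub>) = (*)" "(\<oplus>\<^bsub>poly_ring V\<^esub>) = (+)" "\<one>\<^bsub>poly_ring V\<^esub> = 1" "\<zero>\<^bsub>poly_ring V\<^esub> = 0"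
  by (simp_all add: poly_ring_def)

lemma carrier_poly_ring: "p \<in> carrier (poly_ring V) \<longleftrightarrow> (\<forall>m\<in>keys p. keys m \<subseteq> V)"
  by (simp add: poly_ring_def)

lemma poly_ring_closed [intro]:
  fixes p q :: "('v, 'k::field) mpoly"
  shows "0 \<in> carrier (poly_ring V)" "1 \<in> carrier (poly_ring V)"
    "p \<in> carrier (poly_ring V) \<Longrightarrow> q \<in> carrier (poly_ring V) \<Longrightarrow> p + q \<in> carrier (poly_ring V)"
    "p \<in> carrier (poly_ring V) \<Longrightarrow> q \<in> carrier (poly_ring V) \<Longrightarrow> p - q \<in> carrier (poly_ring V)"
    "p \<in> carrier (poly_ring V) \<Longrightarrow> - p \<in> carrier (poly_ring V)"
    "p \<in> carrier (poly_ring V) \<Longrightarrow> q \<in> carrier (poly_ring V) \<Longrightarrow> p * q \<in> carrier (poly_ring V)"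
    "single 0 c \<in> carrier (poly_ring V)"
  using keys_add[of p q] keys_minus_subset[of p q] keys_mult[of p q]
  by (fastforce simp: carrier_poly_ring keys_uminus keys_add_nat split: if_splits)+

lemma poly_ring_sum_closed:
  "(\<And>i. i \<in> J \<Longrightarrow> f i \<in> carrier (poly_ring V)) \<Longrightarrow> (\<Sum>i\<in>J. f i) \<in> carrier (poly_ring V)"
  for f :: "'i \<Rightarrow> ('v, 'k::field) mpoly"
  by (induction J rule: infinite_finite_induct) auto

lemma poly_ring_power_closed:
  "p \<in> carrier (poly_ring V) \<Longrightarrow> p ^ n \<in> carrier (poly_ring V)" for p :: "('v, 'k::field) mpoly"
  by (induction n) auto

lemma single_in_poly_ring: "keys m \<subseteq> V \<Longrightarrow> single m c \<in> carrier (poly_ring V)"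
  by (simp add: carrier_poly_ring)

lemma cring_poly_ring: "cring (poly_ring V :: ('v, 'k::field) mpoly ring)"
proof (rule cringI)
  show "abelian_group (poly_ring V :: ('v, 'k) mpoly ring)"
  proof (rule abelian_groupI)
    fix x :: "('v, 'k) mpoly" assume "x \<in> carrier (poly_ring V)"
    then show "\<exists>y\<in>carrier (poly_ring V). y \<oplus>\<^bsub>poly_ring V\<^esub> x = \<zero>\<^bsub>poly_ring V\<^esub>"
      by (intro bexI[of _ "- x"]) auto
  qed (auto simp: algebra_simps)
  show "comm_monoid (poly_ring V :: ('v, 'k) mpoly ring)"
    by (rule comm_monoidI) (auto simp: algebra_simps)
qed (auto simp: algebra_simps)

interpretation poly_ring: cring "poly_ring V :: ('v, 'k::field) mpoly ring" for V
  by (rule cring_poly_ring)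

lemma a_inv_poly_ring: "x \<in> carrier (poly_ring V) \<Longrightarrow> \<ominus>\<^bsub>poly_ring V\<^esub> x = - x" for x :: "('v, 'k::field) mpoly"
  by (rule poly_ring.minus_equality) auto

lemma a_minus_poly_ring:
  "x \<in> carrier (poly_ring V) \<Longrightarrow> y \<in> carrier (poly_ring V) \<Longrightarrow> x \<ominus>\<^bsub>poly_ring V\<^esub> y = x - y"
  for x y :: "('v, 'k::field) mpoly"
  by (simp add: a_minus_def a_inv_poly_ring)

lemma ideal_poly_ringI:
  fixes J :: "('v, 'k::field) mpoly set"
  assumes "J \<subseteq> carrier (poly_ring V)" "0 \<in> J" "\<And>x y. x \<in> J \<Longrightarrow> y \<in> J \<Longrightarrow> x + y \<in> J"
    "\<And>x r. x \<in> J \<Longrightarrow> r \<in> carrier (poly_ring V) \<Longrightarrow> r * x \<in> J"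
  shows "ideal J (poly_ring V)"
proof (rule idealI)
  show "ring (poly_ring V :: ('v, 'k) mpoly ring)" by (rule poly_ring.ring_axioms)
  show "subgroup J (add_monoid (poly_ring V))"
  proof
    fix x assume x: "x \<in> J"
    then have "- 1 * x \<in> J" using assms(4)[OF x, of "- 1"] by auto
    moreover have "inv\<^bsub>add_monoid (poly_ring V)\<^esub> x = - x"
      using a_inv_poly_ring[of x V] assms(1) x by (auto simp: a_inv_def)
    ultimately show "inv\<^bsub>add_monoid (poly_ring V)\<^esub> x \<in> J" by simp
  qed (use assms in auto)
qed (use assms in \<open>auto simp: mult.commute\<close>)

lemma ideal_poly_ringD:
  fixes J :: "('v, 'k::field) mpoly set"
  assumes "ideal J (poly_ring V)"
  shows "J \<subseteq> carrier (poly_ring V)" "0 \<in> J" "\<And>x y. x \<in> J \<Longrightarrow> y \<in> J \<Longrightarrow> x + y \<in> J"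
    "\<And>x r. x \<in> J \<Longrightarrow> r \<in> carrier (poly_ring V) \<Longrightarrow> r * x \<in> J"
    "\<And>x. x \<in> J \<Longrightarrow> - x \<in> J"
    "\<And>x y. x \<in> J \<Longrightarrow> y \<in> J \<Longrightarrow> x - y \<in> J"
    "\<And>S f. (\<And>i. i \<in> S \<Longrightarrow> f i \<in> J) \<Longrightarrow> (\<Sum>i\<in>S. f i) \<in> J"
proof -
  interpret J: ideal J "poly_ring V" by fact
  show sub: "J \<subseteq> carrier (poly_ring V)" using J.a_subset .
  show zero: "0 \<in> J" using J.zero_closed by simp
  show add: "\<And>x y. x \<in> J \<Longrightarrow> y \<in> J \<Longrightarrow> x + y \<in> J" using J.a_closed by simp
  show mult: "\<And>x r. x \<in> J \<Longrightarrow> r \<in> carrier (poly_ring V) \<Longrightarrow> r * x \<in> J" using J.I_l_closed by simp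
  show uminus: "\<And>x. x \<in> J \<Longrightarrow> - x \<in> J" using mult[of _ "- 1"] by auto
  show "\<And>x y. x \<in> J \<Longrightarrow> y \<in> J \<Longrightarrow> x - y \<in> J" using add[OF _ uminus] by simp
  show "(\<Sum>i\<in>S. f i) \<in> J" if "\<And>i. i \<in> S \<Longrightarrow> f i \<in> J" for S and f :: "'i \<Rightarrow> ('v, 'k) mpoly"
    using that by (induction S rule: infinite_finite_induct) (auto simp: zero add)
qed

section \<open>Hibi rings of planar lattices\<close>

text \<open>
  The toric map sends the variable at \<open>(i, j)\<close> to \<open>s\<^sub>i t\<^sub>j\<close>, where \<open>s\<^sub>i\<close> is the variable with
  index \<open>i\<close> and \<open>t\<^sub>j\<close> the one with index \<open>- 1 - j\<close>; the two kinds do not collide because the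
  coordinates are nonnegative. Indexing by the linearly ordered type \<^typ>\<open>real\<close> makes the target
  ring an instance of \<^class>\<open>idom\<close>. Variables outside \<open>D\<close> are sent to zero.
\<close>

definition toric_exponent :: "(real \<times> real \<Rightarrow>\<^sub>0 nat) \<Rightarrow> (real \<Rightarrow>\<^sub>0 nat)" where
  "toric_exponent = additive_extension (\<lambda>v k. single (fst v) k + single (- 1 - snd v) k)"

definition toric_weight :: "(real \<times> real) set \<Rightarrow> (real \<times> real \<Rightarrow>\<^sub>0 nat) \<Rightarrow> (real, 'k::field) mpoly" where
  "toric_weight D m = (if keys m \<subseteq> D then single (toric_exponent m) 1 else 0)"

definition toric_map :: "(real \<times> real) set \<Rightarrow> (real \<times> real, 'k::field) mpoly \<Rightarrow> (real, 'k) mpoly" where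
  "toric_map D = linear_extension (toric_weight D)"

text \<open>For \<open>D = UNIV\<close> this will be the ideal of the polyomino; smaller sets
  \<open>D\<close> provide the primes above it.\<close>

definition toric_kernel :: "(real \<times> real) set \<Rightarrow> (real \<times> real) set \<Rightarrow> (real \<times> real, 'k::field) mpoly set" where
  "toric_kernel V D = {p \<in> carrier (poly_ring V). toric_map D p = 0}"

definition chain_monomials :: "(real \<times> real) set \<Rightarrow> (real \<times> real \<Rightarrow>\<^sub>0 nat) set" where
  "chain_monomials V = {m. keys m \<subseteq> V \<and> (\<forall>a\<in>keys m. \<forall>b\<in>keys m. a \<le> b \<or> b \<le> a)}"

lemma toric_exponent_zero [simp]: "toric_exponent 0 = 0"
  by (simp add: toric_exponent_def additive_extension_zero)

lemma toric_exponent_add: "toric_exponent (m + n) = toric_exponent m + toric_exponent n"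
  unfolding toric_exponent_def by (rule additive_extension_add) (auto simp: single_add algebra_simps)

lemma toric_exponent_single: "toric_exponent (single v k) = single (fst v) k + single (- 1 - snd v) k"
  unfolding toric_exponent_def by (rule additive_extension_single) simp

lemma toric_weight_add: "toric_weight D (m + n) = toric_weight D m * toric_weight D n"
  by (auto simp: toric_weight_def keys_add_nat toric_exponent_add mult_single)

lemma toric_weight_zero [simp]: "toric_weight D 0 = 1"
  by (simp add: toric_weight_def)

lemma toric_map_simps [simp]:
  "toric_map D 0 = 0" "toric_map D 1 = 1" "toric_map D (p + q) = toric_map D p + toric_map D q"
  "toric_map D (p - q) = toric_map D p - toric_map D q"
  "toric_map D (p * q) = toric_map D p * toric_map D q"
  "toric_map D (single m c) = single 0 c * toric_weight D m"
  "toric_map D (\<Sum>i\<in>J. f i) = (\<Sum>i\<in>J. toric_map D (f i))"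
  using linear_extension_single[of "toric_weight D" 0 1]
  by (auto simp: toric_map_def linear_extension_add linear_extension_diff linear_extension_sum
      toric_weight_add linear_extension_mult)

lemma keys_sum_nat: "finite J \<Longrightarrow> keys (\<Sum>i\<in>J. f i) = (\<Union>i\<in>J. keys (f i))"
  for f :: "'i \<Rightarrow> 'a \<Rightarrow>\<^sub>0 nat"
  by (induction J rule: finite_induct) (auto simp: keys_add_nat)

lemma keys_toric_exponent: "keys (toric_exponent m) = fst ` keys m \<union> (\<lambda>v. - 1 - snd v) ` keys m"
  unfolding toric_exponent_def additive_extension_def
  by (subst keys_sum_nat) (auto simp: keys_add_nat in_keys_iff split: if_splits)

lemma lookup_toric_map:
  "lookup (toric_map D p) e = (\<Sum>m\<in>keys p. if keys m \<subseteq> D \<and> toric_exponent m = e then lookup p m else 0)"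
  unfolding toric_map_def linear_extension_def lookup_sum
  by (intro sum.cong refl) (auto simp: toric_weight_def mult_single lookup_single when_def)

text \<open>Kernel of a ring homomorphism into an integral domain. The map is multiplicative for
  every \<open>D\<close> because a product of monomials is supported in \<open>D\<close> exactly
  when both factors are.\<close>

lemma primeideal_toric_kernel: "primeideal (toric_kernel V D :: (real \<times> real, 'k::field) mpoly set) (poly_ring V)"
proof (rule primeidealI)
  show "ideal (toric_kernel V D :: (real \<times> real, 'k) mpoly set) (poly_ring V)"
    by (rule ideal_poly_ringI) (auto simp: toric_kernel_def)
  show "cring (poly_ring V :: (real \<times> real, 'k) mpoly ring)" by (rule cring_poly_ring)
  have "(1 :: (real \<times> real, 'k) mpoly) \<notin> toric_kernel V D" by (simp add: toric_kernel_def)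
  then show "carrier (poly_ring V) \<noteq> (toric_kernel V D :: (real \<times> real, 'k) mpoly set)" by blast
qed (auto simp: toric_kernel_def)

text \<open>If support in \<open>D'\<close> can be read off the toric exponent, then the image under
  \<open>toric_map D'\<close> arises from that under \<open>toric_map D\<close> by deleting the
  terms whose exponent leaves \<open>E\<close>.\<close>

lemma toric_kernel_mono:
  assumes "D' \<subseteq> D" "\<And>m. keys m \<subseteq> V \<Longrightarrow> keys m \<subseteq> D' \<longleftrightarrow> keys (toric_exponent m) \<subseteq> E"
  shows "toric_kernel V D \<subseteq> toric_kernel V D'"
proof
  fix p :: "(real \<times> real, 'k::field) mpoly" assume p: "p \<in> toric_kernel V D"
  then have V: "keys m \<subseteq> V" if "m \<in> keys p" for m
    using that by (auto simp: toric_kernel_def carrier_poly_ring)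
  have "(if keys m \<subseteq> D' \<and> toric_exponent m = e then lookup p m else 0) =
      (if keys e \<subseteq> E then if keys m \<subseteq> D \<and> toric_exponent m = e then lookup p m else 0 else 0)"
    if "m \<in> keys p" for m e
    using assms(1) assms(2)[OF V[OF that]] by auto
  then have "lookup (toric_map D' p) e = (if keys e \<subseteq> E then lookup (toric_map D p) e else 0)" for e
    unfolding lookup_toric_map by (cases "keys e \<subseteq> E") (simp_all cong: sum.cong)
  then show "p \<in> toric_kernel V D'"
    using p by (auto simp: toric_kernel_def poly_mapping_eq_iff fun_eq_iff)
qed

definition join_meet_binomials :: "(real \<times> real) set \<Rightarrow> (real \<times> real, 'k::field) mpoly set" where
  "join_meet_binomials V = {var a * var b - var (fst b, snd a) * var (fst a, snd b) | a b.
          a \<in> V \<and> b \<in> V \<and> a \<le> b \<and> (fst b, snd a) \<in> V \<and> (fst a, snd b) \<in> V}"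

lemma var_mult_var: "var a * var b = single (single a 1 + single b 1) (1 :: 'k::field)"
  by (simp add: var_def mult_single)

lemma keys_two: "keys (single a (1::nat) + single b 1) = {a, b}"
  by (auto simp: keys_add_nat)

text \<open>Opposite corners of a rectangle use the same coordinates, so both terms of a binomial
  have the same toric exponent; the condition on \<open>D\<close> makes the map kill both terms or
  neither.\<close>

lemma join_meet_binomials_subset_toric_kernel:
  assumes "\<And>a b. a \<le> b \<Longrightarrow> {a, b} \<subseteq> D \<longleftrightarrow> {(fst b, snd a), (fst a, snd b)} \<subseteq> D"
  shows "join_meet_binomials V \<subseteq> toric_kernel V D"
proof
  fix p :: "(real \<times> real, 'k::field) mpoly" assume "p \<in> join_meet_binomials V"
  then obtain a b where p: "p = var a * var b - var (fst b, snd a) * var (fst a, snd b)"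
    and ab: "a \<in> V" "b \<in> V" "a \<le> b" "(fst b, snd a) \<in> V" "(fst a, snd b) \<in> V"
    by (auto simp: join_meet_binomials_def)
  let ?m = "single a (1::nat) + single b 1" and ?n = "single (fst b, snd a) (1::nat) + single (fst a, snd b) 1"
  have eq: "toric_exponent ?m = toric_exponent ?n"
    by (simp add: toric_exponent_add toric_exponent_single algebra_simps)
  have keys: "keys ?m \<subseteq> D \<longleftrightarrow> keys ?n \<subseteq> D"
    unfolding keys_two using assms[OF ab(3)] .
  have "toric_weight D ?m = (toric_weight D ?n :: (real, 'k) mpoly)"
    unfolding toric_weight_def eq keys ..
  then have "toric_map D p = 0"
    unfolding p var_mult_var by simp
  moreover have "p \<in> carrier (poly_ring V)"
    unfolding p var_mult_var using ab by (intro poly_ring_closed single_in_poly_ring) (simp_all add: keys_add_nat)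
  ultimately show "p \<in> toric_kernel V D" by (simp add: toric_kernel_def)
qed

text \<open>
  A chain monomial is recovered from its toric exponent by splitting off its largest variable,
  both of whose coordinates are maximal.
\<close>

lemma toric_exponent_inj_on:
  assumes V: "V \<subseteq> {0..} \<times> {0..}"
  shows "inj_on toric_exponent (chain_monomials V)"
proof -
  \<comment> \<open>Equal exponents give equal sets of first coordinates and equal sets of second
    coordinates, the signs of the indices keeping the two kinds apart. Hence the top of
    \<open>m'\<close> also bounds \<open>m\<close>; by symmetry the two tops will coincide.\<close>
  have le: "\<exists>a\<in>keys m'. \<forall>v\<in>keys m. v \<le> a"
    if m: "m \<in> chain_monomials V" "m' \<in> chain_monomials V" "toric_exponent m = toric_exponent m'" "m \<noteq> 0" for m m'
  proof -
    have ne: "keys m \<noteq> {}" using m(4) by (metis keys_eq_empty)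
    have nonneg: "0 \<le> fst v" "0 \<le> snd v" if "v \<in> keys m \<or> v \<in> keys m'" for v
      using that m V by (auto simp: chain_monomials_def)
    have keys: "fst ` keys m \<union> (\<lambda>v. - 1 - snd v) ` keys m = fst ` keys m' \<union> (\<lambda>v. - 1 - snd v) ` keys m'"
      using m(3) keys_toric_exponent by metis
    have proj: "\<exists>u\<in>keys m'. fst u = fst v" "\<exists>u\<in>keys m'. snd u = snd v" if v: "v \<in> keys m" for v
    proof -
      have "fst v \<in> fst ` keys m' \<union> (\<lambda>v. - 1 - snd v) ` keys m'" using keys v by blast
      then obtain u where "u \<in> keys m'" "fst v = fst u \<or> fst v = - 1 - snd u" by blast
      then show "\<exists>u\<in>keys m'. fst u = fst v" using nonneg(1)[of v] nonneg(2)[of u] v by fastforce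
      have "- 1 - snd v \<in> fst ` keys m' \<union> (\<lambda>v. - 1 - snd v) ` keys m'" using keys v by blast
      then obtain u where "u \<in> keys m'" "- 1 - snd v = fst u \<or> - 1 - snd v = - 1 - snd u" by blast
      then show "\<exists>u\<in>keys m'. snd u = snd v" using nonneg(2)[of v] nonneg(1)[of u] v by fastforce
    qed
    have "\<exists>a\<in>keys m'. \<forall>u\<in>keys m'. u \<le> a"
    proof -
      have "keys m' \<noteq> {}" using proj(1) ne by blast
      then obtain a where a: "a \<in> keys m'" "\<And>u. u \<in> keys m' \<Longrightarrow> a \<le> u \<Longrightarrow> u = a"
        using finite_has_maximal[of "keys m'"] finite_keys by metis
      then show ?thesis using m(2) unfolding chain_monomials_def by blast
    qed
    then obtain a where "a \<in> keys m'" "\<forall>u\<in>keys m'. u \<le> a" by blast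
    then show ?thesis using proj by (intro bexI[of _ a]) (auto simp: less_eq_prod_def, metis, metis)
  qed
  have "m = m'" if "m \<in> chain_monomials V" "m' \<in> chain_monomials V" "toric_exponent m = toric_exponent m'" for m m'
    using that
  proof (induction "monomial_degree m" arbitrary: m m')
    case 0
    then have "m = 0" by (simp add: monomial_degree_eq_0_iff)
    then have "keys m' = {}" using 0 keys_toric_exponent[of m'] by simp
    then show ?case using \<open>m = 0\<close> by simp
  next
    case (Suc n)
    then have "m \<noteq> 0" by auto
    moreover have "m' \<noteq> 0"
    proof
      assume "m' = 0"
      then have "keys m = {}" using Suc.prems(3) keys_toric_exponent[of m] by simp
      then show False using \<open>m \<noteq> 0\<close> by simp
    qed
    ultimately obtain a a' where a: "a \<in> keys m'" "\<forall>v\<in>keys m. v \<le> a" and a': "a' \<in> keys m" "\<forall>v\<in>keys m'. v \<le> a'"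
      using le[of m m'] le[of m' m] Suc.prems by metis
    then have "a = a'" by (meson order.antisym)
    obtain r where r: "m = single a 1 + r" using split_single[of a m] a' \<open>a = a'\<close> by blast
    obtain r' where r': "m' = single a 1 + r'" using split_single[of a m'] a by blast
    have "r = r'"
    proof (rule Suc.hyps(1))
      show "n = monomial_degree r" using Suc.hyps(2) by (simp add: r monomial_degree_add)
      show "r \<in> chain_monomials V" "r' \<in> chain_monomials V"
        using Suc.prems(1,2) by (auto simp: r r' chain_monomials_def keys_add_nat)
      show "toric_exponent r = toric_exponent r'" using Suc.prems(3) by (simp add: r r' toric_exponent_add)
    qed
    then show ?case by (simp add: r r')
  qed
  then show ?thesis by (auto intro: inj_onI)
qed

locale hibi =
  fixes V :: "(real \<times> real) set" and I :: "(real \<times> real, 'k::field) mpoly set"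
  assumes finite_V: "finite V" and V_nonneg: "V \<subseteq> {0..} \<times> {0..}"
    and inf_V: "u \<in> V \<Longrightarrow> v \<in> V \<Longrightarrow> inf u v \<in> V"
    and sup_V: "u \<in> V \<Longrightarrow> v \<in> V \<Longrightarrow> sup u v \<in> V"
    and I_eq: "I = Idl\<^bsub>poly_ring V\<^esub> (join_meet_binomials V)"
begin

abbreviation "P \<equiv> poly_ring V :: (real \<times> real, 'k) mpoly ring"

lemma binomials_subset: "(join_meet_binomials V :: (real \<times> real, 'k) mpoly set) \<subseteq> carrier P"
  using join_meet_binomials_subset_toric_kernel[of UNIV V] by (auto simp: toric_kernel_def)

lemma ideal_I: "ideal I P"
  unfolding I_eq by (rule poly_ring.genideal_ideal[OF binomials_subset])

lemmas I_closed = ideal_poly_ringD[OF ideal_I]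

lemma I_subset_toric_kernel:
  assumes "\<And>a b. a \<le> b \<Longrightarrow> {a, b} \<subseteq> D \<longleftrightarrow> {(fst b, snd a), (fst a, snd b)} \<subseteq> D"
  shows "I \<subseteq> toric_kernel V D"
  unfolding I_eq
  by (intro poly_ring.genideal_minimal join_meet_binomials_subset_toric_kernel assms)
     (rule primeideal.axioms(1)[OF primeideal_toric_kernel])

lemma toric_map_I: "p \<in> I \<Longrightarrow> toric_map UNIV p = 0"
  using I_subset_toric_kernel[of UNIV] by (auto simp: toric_kernel_def)

text \<open>Incomparable \<open>a\<close> and \<open>b\<close> are the two remaining corners of the
  rectangle spanned by their meet and join. The difference is therefore a generator times the
  monomial \<open>r\<close>, up to sign.\<close>

lemma exchange:
  assumes "a \<in> V" "b \<in> V" "\<not> a \<le> b" "\<not> b \<le> a" "keys r \<subseteq> V"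
  shows "single (single a 1 + single b 1 + r) 1 - single (single (inf a b) 1 + single (sup a b) 1 + r) 1 \<in> I"
proof -
  let ?i = "inf a b" and ?s = "sup a b"
  have V: "?i \<in> V" "?s \<in> V" using assms inf_V sup_V by auto
  have "{(fst ?s, snd ?i), (fst ?i, snd ?s)} = {a, b}"
  proof (cases "fst a \<le> fst b")
    case True
    then have "snd b \<le> snd a" using assms(3) by (auto simp: less_eq_prod_def)
    then show ?thesis using True
      by (cases a; cases b) (auto simp: inf_prod_def sup_prod_def inf_min sup_max)
  next
    case False
    then have "snd a \<le> snd b" using assms(4) by (auto simp: less_eq_prod_def)
    then show ?thesis using False
      by (cases a; cases b) (auto simp: inf_prod_def sup_prod_def inf_min sup_max)
  qed
  then have swap: "(fst ?s, snd ?i) = a \<and> (fst ?i, snd ?s) = b \<or> (fst ?s, snd ?i) = b \<and> (fst ?i, snd ?s) = a"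
    by (simp only: doubleton_eq_iff)
  then have "var (fst ?s, snd ?i) * var (fst ?i, snd ?s) = (var a * var b :: (real \<times> real, 'k) mpoly)"
    by (metis mult.commute)
  moreover have "var ?i * var ?s - var (fst ?s, snd ?i) * var (fst ?i, snd ?s)
      \<in> (join_meet_binomials V :: (real \<times> real, 'k) mpoly set)"
  proof -
    have "(fst ?s, snd ?i) \<in> V \<and> (fst ?i, snd ?s) \<in> V"
      using swap assms(1,2) by metis
    moreover have "?i \<le> ?s" by (rule order.trans[OF inf_le1 sup_ge1])
    ultimately show ?thesis unfolding join_meet_binomials_def using V by blast
  qed
  ultimately have "var ?i * var ?s - var a * var b \<in> I"
    using poly_ring.genideal_self[OF binomials_subset] unfolding I_eq by auto
  then have "single r 1 * (var ?i * var ?s - var a * var b) \<in> I"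
    using assms(5) by (intro I_closed(4) single_in_poly_ring) auto
  then have "- (single r 1 * (var ?i * var ?s - var a * var b)) \<in> I" by (rule I_closed(5))
  then show ?thesis unfolding var_mult_var by (simp add: algebra_simps mult_single)
qed

text \<open>
  Among the monomials congruent to \<open>m\<close>, one that maximizes the sum of the products of the
  coordinates of its variables admits no further exchange, so it is a chain monomial.
\<close>

lemma straightening:
  assumes "keys m \<subseteq> V"
  shows "\<exists>m'\<in>chain_monomials V. monomial_degree m' = monomial_degree m \<and> single m 1 - single m' 1 \<in> I"
proof -
  define S where "S = {m'. keys m' \<subseteq> V \<and> monomial_degree m' = monomial_degree m \<and> single m 1 - single m' 1 \<in> I}"
  define Q where "Q = additive_extension (\<lambda>v k. real k * (fst v * snd v))"
  have Q_add: "Q (m + n) = Q m + Q n" for m n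
    unfolding Q_def by (rule additive_extension_add) (auto simp: algebra_simps)
  have Q_single: "Q (single v (Suc 0)) = fst v * snd v" for v
    unfolding Q_def by (subst additive_extension_single) auto
  have "finite S"
    by (rule finite_subset[OF _ finite_monomials_le[OF finite_V, of "monomial_degree m"]]) (auto simp: S_def)
  moreover have "m \<in> S" using assms I_closed(2) by (simp add: S_def)
  ultimately obtain n where n: "n \<in> S" and max: "\<And>n'. n' \<in> S \<Longrightarrow> Q n' \<le> Q n"
    using Max_in[of "Q ` S"] Max_ge[of "Q ` S"] by (metis (no_types, lifting) finite_imageI image_iff empty_iff imageI)
  have "n \<in> chain_monomials V"
  proof (rule ccontr)
    assume "n \<notin> chain_monomials V"
    then obtain a b where ab: "a \<in> keys n" "b \<in> keys n" "\<not> a \<le> b" "\<not> b \<le> a"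
      using n by (auto simp: chain_monomials_def S_def)
    obtain r0 where r0: "n = single a 1 + r0" using split_single[OF ab(1)] .
    have "b \<in> keys r0" using ab(2,3) by (auto simp: r0 keys_add_nat split: if_splits)
    then obtain r where "r0 = single b 1 + r" by (rule split_single)
    then have r: "n = single a 1 + single b 1 + r" by (simp add: r0 add.assoc)
    have V: "a \<in> V" "b \<in> V" "keys r \<subseteq> V" using n by (auto simp: S_def r keys_add_nat)
    let ?n = "single (inf a b) 1 + single (sup a b) 1 + r"
    have "single n 1 - single ?n 1 \<in> I" using exchange[OF V(1,2) ab(3,4) V(3)] by (simp add: r)
    from I_closed(3)[OF _ this, of "single m 1 - single n 1"] n
    have "single m 1 - single ?n 1 \<in> I" by (simp add: S_def)
    then have "?n \<in> S" using n V inf_V sup_V by (simp add: S_def r monomial_degree_add keys_add_nat)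
    from max[OF this] have "fst (inf a b) * snd (inf a b) + fst (sup a b) * snd (sup a b) \<le> fst a * snd a + fst b * snd b"
      by (simp add: r Q_add Q_single)
    moreover have "fst a * snd a + fst b * snd b < fst (inf a b) * snd (inf a b) + fst (sup a b) * snd (sup a b)"
    proof (cases "fst a \<le> fst b")
      case True
      then have "snd b < snd a" "fst a < fst b" using ab(3,4) by (auto simp: less_eq_prod_def)
      \<comment> \<open>This product is the gain in \<open>Q\<close> from replacing \<open>a\<close>
        and \<open>b\<close> by their meet and join.\<close>
      moreover from this have "0 < (fst b - fst a) * (snd a - snd b)" by simp
      ultimately show ?thesis by (simp add: inf_min sup_max algebra_simps)
    next
      case False
      then have "snd a < snd b" "fst b < fst a" using ab(3,4) by (auto simp: less_eq_prod_def)
      moreover from this have "0 < (fst a - fst b) * (snd b - snd a)" by simp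
      ultimately show ?thesis by (simp add: inf_min sup_max algebra_simps)
    qed
    ultimately show False by simp
  qed
  then show ?thesis using n by (auto simp: S_def)
qed

text \<open>Degrees are controlled as a set, so that the statement serves homogeneous components as
  well as the filtration by \<open>degree_le\<close>.\<close>

lemma normal_form:
  assumes "p \<in> carrier P"
  shows "\<exists>q. keys q \<subseteq> chain_monomials V \<and> monomial_degree ` keys q \<subseteq> monomial_degree ` keys p \<and> p - q \<in> I"
proof -
  have "\<forall>m\<in>keys p. \<exists>m'\<in>chain_monomials V. monomial_degree m' = monomial_degree m \<and> single m 1 - single m' 1 \<in> I"
    using assms straightening by (auto simp: carrier_poly_ring)
  then obtain s where s: "\<And>m. m \<in> keys p \<Longrightarrow> s m \<in> chain_monomials V"
    "\<And>m. m \<in> keys p \<Longrightarrow> monomial_degree (s m) = monomial_degree m"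
    "\<And>m. m \<in> keys p \<Longrightarrow> single m 1 - single (s m) 1 \<in> I"
    by metis
  let ?q = "\<Sum>m\<in>keys p. single (s m) (lookup p m)"
  have keys: "keys ?q \<subseteq> s ` keys p"
    by (rule order.trans[OF keys_sum_subset]) (auto split: if_splits)
  have "p - ?q = (\<Sum>m\<in>keys p. single m (lookup p m) - single (s m) (lookup p m))"
    by (simp add: sum_subtractf poly_mapping_sum_singles)
  also have "\<dots> = (\<Sum>m\<in>keys p. single 0 (lookup p m) * (single m 1 - single (s m) 1))"
    by (simp add: algebra_simps mult_single)
  also have "\<dots> \<in> I" by (rule I_closed(7), rule I_closed(4)[OF s(3)]) auto
  finally have "p - ?q \<in> I" .
  moreover have "keys ?q \<subseteq> chain_monomials V" using keys s(1) by blast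
  moreover have "monomial_degree ` keys ?q \<subseteq> monomial_degree ` keys p"
  proof -
    have "monomial_degree ` keys ?q \<subseteq> monomial_degree ` s ` keys p" using keys by (rule image_mono)
    also have "\<dots> = monomial_degree ` keys p" using s(2) by (simp add: image_image)
    finally show ?thesis .
  qed
  ultimately show ?thesis by blast
qed

text \<open>Chain monomials have distinct toric exponents, so no cancellation occurs and each
  coefficient of \<open>q\<close> reappears in the image.\<close>

lemma toric_map_chain_eq_0:
  assumes "keys q \<subseteq> chain_monomials V" "toric_map UNIV q = 0"
  shows "q = 0"
proof (rule poly_mapping_eqI)
  fix m
  show "lookup q m = lookup 0 m"
  proof (cases "m \<in> keys q")
    case True
    have "lookup (toric_map UNIV q) (toric_exponent m) = (\<Sum>n\<in>keys q. if n = m then lookup q n else 0)"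
      unfolding lookup_toric_map
      using inj_onD[OF toric_exponent_inj_on[OF V_nonneg]] assms(1) True by (intro sum.cong) auto
    then show ?thesis using True assms(2) by simp
  qed (simp add: in_keys_iff)
qed

text \<open>An element of the kernel has a normal form that is also mapped to 0 and hence vanishes.
  Linear independence modulo \<open>I\<close> can therefore be tested on toric images.\<close>

lemma I_eq_toric_kernel: "I = toric_kernel V UNIV"
proof
  show "I \<subseteq> toric_kernel V UNIV" by (rule I_subset_toric_kernel) auto
  show "toric_kernel V UNIV \<subseteq> I"
  proof
    fix p :: "(real \<times> real, 'k) mpoly" assume p: "p \<in> toric_kernel V UNIV"
    then have "p \<in> carrier P" by (simp add: toric_kernel_def)
    then obtain q where q: "keys q \<subseteq> chain_monomials V" "p - q \<in> I"
      using normal_form by blast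
    have "toric_map UNIV q = 0" using toric_map_I[OF q(2)] p by (simp add: toric_kernel_def)
    then show "p \<in> I" using toric_map_chain_eq_0[OF q(1)] q(2) by simp
  qed
qed

end

section \<open>The quotient algebra and the dimensions of its graded components\<close>

context hibi
begin

abbreviation "A \<equiv> P Quot I"
abbreviation cls :: "(real \<times> real, 'k) mpoly \<Rightarrow> (real \<times> real, 'k) mpoly set" where
  "cls p \<equiv> I +>\<^bsub>P\<^esub> p"

lemma cls_hom: "ring_hom_ring P A cls"
  using ideal.rcos_ring_hom_ring[OF ideal_I] .

lemma ring_A: "ring A" and cring_A: "cring A"
  using ideal.quotient_is_ring[OF ideal_I] ideal.quotient_is_cring[OF ideal_I cring_poly_ring] .

lemma cls_closed: "p \<in> carrier P \<Longrightarrow> cls p \<in> carrier A"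
  using ring_hom_ring.homh[OF cls_hom] by (auto simp: ring_hom_def)

lemma cls_add: "p \<in> carrier P \<Longrightarrow> q \<in> carrier P \<Longrightarrow> cls p \<oplus>\<^bsub>A\<^esub> cls q = cls (p + q)"
  and cls_mult: "p \<in> carrier P \<Longrightarrow> q \<in> carrier P \<Longrightarrow> cls p \<otimes>\<^bsub>A\<^esub> cls q = cls (p * q)"
  and cls_one: "\<one>\<^bsub>A\<^esub> = cls 1"
  using ring_hom_ring.homh[OF cls_hom] by (auto simp: ring_hom_def)

lemma zero_A: "\<zero>\<^bsub>A\<^esub> = I" by (simp add: FactRing_def)

lemma cls_eq_iff: "p \<in> carrier P \<Longrightarrow> q \<in> carrier P \<Longrightarrow> cls p = cls q \<longleftrightarrow> p - q \<in> I"
  using poly_ring.quotient_eq_iff_same_a_r_cos[OF ideal_I] a_minus_poly_ring by metis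

lemma cls_eq_zero_iff: "p \<in> carrier P \<Longrightarrow> cls p = \<zero>\<^bsub>A\<^esub> \<longleftrightarrow> p \<in> I"
  using cls_eq_iff[of p 0] poly_ring.a_rcos_zero[OF ideal_I, of 0] I_closed(2) by (auto simp: zero_A)

lemma carrier_A: "a \<in> carrier A \<Longrightarrow> \<exists>p\<in>carrier P. a = cls p"
  by (auto simp: FactRing_def A_RCOSETS_def')

lemma one_notin_I: "1 \<notin> I"
  using toric_map_I[of 1] by auto

lemma subfield_constants: "subfield constants P"
proof (rule poly_ring.subfieldI)
  have "subring constants P"
  proof (rule poly_ring.subringI)
    show "constants \<subseteq> carrier P" by (auto simp: constants_def)
    show "\<one>\<^bsub>P\<^esub> \<in> constants" by (auto simp: constants_def intro!: image_eqI[of _ _ 1])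
  next
    fix h :: "(real \<times> real, 'k) mpoly" assume "h \<in> constants"
    then obtain c where "h = single 0 c" by (auto simp: constants_def)
    then show "\<ominus>\<^bsub>P\<^esub> h \<in> constants"
      by (auto simp: a_inv_poly_ring poly_ring_closed constants_def single_uminus intro!: image_eqI[of _ _ "- c"])
  next
    fix g h :: "(real \<times> real, 'k) mpoly" assume "g \<in> constants" "h \<in> constants"
    then obtain c d where "g = single 0 c" "h = single 0 d" by (auto simp: constants_def)
    then show "g \<otimes>\<^bsub>P\<^esub> h \<in> constants" "g \<oplus>\<^bsub>P\<^esub> h \<in> constants"
      by (auto simp: constants_def mult_single single_add[symmetric])
  qed
  then show "subcring constants P" by (rule poly_ring.subcringI')
  have "x \<in> Units (P\<lparr>carrier := constants\<rparr>) \<longleftrightarrow> x \<in> constants - {0}" for x :: "(real \<times> real, 'k) mpoly"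
  proof
    assume "x \<in> Units (P\<lparr>carrier := constants\<rparr>)"
    then show "x \<in> constants - {0}" by (auto simp: Units_def)
  next
    assume "x \<in> constants - {0}"
    then obtain c where c: "x = single 0 c" "x \<noteq> 0" by (auto simp: constants_def)
    from c have "c \<noteq> 0" by auto
    with c(1) have "single 0 (inverse c) * x = 1" "x * single 0 (inverse c) = 1" by (auto simp: mult_single)
    then show "x \<in> Units (P\<lparr>carrier := constants\<rparr>)"
      unfolding Units_def using c(1) by (auto simp: constants_def)
  qed
  then show "Units (P\<lparr>carrier := constants\<rparr>) = constants - {\<zero>\<^bsub>P\<^esub>}" by auto
qed

lemma subfield_cls_constants: "subfield (cls ` constants) A"
proof (rule ring_hom_ring.img_is_subfield(2)[OF cls_hom subfield_constants])
  show "\<one>\<^bsub>A\<^esub> \<noteq> \<zero>\<^bsub>A\<^esub>"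
    using cls_eq_zero_iff[of 1] one_notin_I by (auto simp: cls_one)
qed

text \<open>\<open>ring.dimension\<close> is built by successive line extensions, which is why the
  monomials come as a list. The head adds one dimension, since independence keeps its class out of
  the span of the tail.\<close>

lemma dimension_chain_monomials:
  assumes "distinct ms" "set ms \<subseteq> chain_monomials V"
  shows "ring.dimension A (length ms) (cls ` constants) (cls ` {p. keys p \<subseteq> set ms})"
  using assms
proof (induction ms)
  case Nil
  have "{p :: (real \<times> real, 'k) mpoly. keys p \<subseteq> set []} = {0}" by auto
  moreover have "cls 0 = \<zero>\<^bsub>A\<^esub>" using cls_eq_zero_iff[of 0] I_closed(2) by auto
  ultimately show ?case using ring.zero_dim[OF ring_A] by simp
next
  case (Cons m ms)
  let ?E = "cls ` {p. keys p \<subseteq> set ms}"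
  have car: "p \<in> carrier P" if "keys p \<subseteq> set (m # ms)" for p :: "(real \<times> real, 'k) mpoly"
    using that Cons.prems(2) unfolding carrier_poly_ring chain_monomials_def by blast
  have m: "single m 1 \<in> carrier P" by (rule car) simp
  have notin: "cls (single m 1) \<notin> ?E"
  proof
    assume "cls (single m 1) \<in> ?E"
    then obtain p where p: "keys p \<subseteq> set ms" "cls (single m 1) = cls p" by auto
    have "p \<in> carrier P" using p(1) by (intro car) auto
    then have "single m 1 - p \<in> I" using p(2) cls_eq_iff[OF m] by simp
    then have "toric_map UNIV (single m 1 - p) = 0" by (rule toric_map_I)
    moreover have "keys (single m 1 - p) \<subseteq> chain_monomials V"
      by (rule order.trans[OF keys_minus_subset]) (use Cons.prems(2) p(1) in auto)
    ultimately have "single m 1 - p = 0" by (rule toric_map_chain_eq_0[rotated])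
    then have "p = single m 1" by simp
    then have "keys p = {m}" by simp
    then show False using p(1) Cons.prems(1) by auto
  qed
  have "ring.line_extension A (cls ` constants) (cls (single m 1)) ?E = cls ` {p. keys p \<subseteq> set (m # ms)}"
  proof (intro equalityI subsetI)
    fix x assume "x \<in> ring.line_extension A (cls ` constants) (cls (single m 1)) ?E"
    then obtain c p where x: "x = cls (single 0 c) \<otimes>\<^bsub>A\<^esub> cls (single m 1) \<oplus>\<^bsub>A\<^esub> cls p" and p: "keys p \<subseteq> set ms"
      unfolding ring.line_extension_mem_iff[OF ring_A] constants_def by auto
    have "p \<in> carrier P" using p by (intro car) auto
    then have "x = cls (single 0 c * single m 1 + p)"
      unfolding x using m by (simp add: cls_mult cls_add poly_ring_closed)
    moreover have "keys (single 0 c * single m 1 + p) \<subseteq> set (m # ms)"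
      by (rule order.trans[OF keys_add]) (use p in \<open>auto simp: mult_single\<close>)
    ultimately show "x \<in> cls ` {p. keys p \<subseteq> set (m # ms)}" by blast
  next
    fix x assume "x \<in> cls ` {p. keys p \<subseteq> set (m # ms)}"
    then obtain p where p: "keys p \<subseteq> set (m # ms)" "x = cls p" by auto
    define q where "q = p - single m (lookup p m)"
    have q: "keys q \<subseteq> set ms"
    proof
      fix n assume n: "n \<in> keys q"
      then have "n \<in> keys p" "n \<noteq> m"
        by (auto simp: q_def in_keys_iff lookup_minus lookup_single when_def split: if_splits)
      then show "n \<in> set ms" using p(1) by auto
    qed
    have "q \<in> carrier P" using q by (intro car) auto
    moreover have "p = single 0 (lookup p m) * single m 1 + q" by (simp add: q_def mult_single)
    ultimately have "x = cls (single 0 (lookup p m)) \<otimes>\<^bsub>A\<^esub> cls (single m 1) \<oplus>\<^bsub>A\<^esub> cls q"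
      unfolding p(2) using m by (simp add: cls_mult cls_add poly_ring_closed)
    then show "x \<in> ring.line_extension A (cls ` constants) (cls (single m 1)) ?E"
      unfolding ring.line_extension_mem_iff[OF ring_A] constants_def using q by blast
  qed
  moreover have "ring.dimension A (Suc (length ms)) (cls ` constants)
      (ring.line_extension A (cls ` constants) (cls (single m 1)) ?E)"
    using Cons by (intro ring.Suc_dim[OF ring_A cls_closed[OF m] notin]) auto
  ultimately show ?case by simp
qed

lemma finite_chain_monomials: "finite {m \<in> chain_monomials V. monomial_degree m \<le> n}"
  by (rule finite_subset[OF _ finite_monomials_le[OF finite_V, of n]]) (auto simp: chain_monomials_def)

lemma dim_homogeneous:
  "ring.dim A (cls ` constants) (cls ` homogeneous_polys V n) =
     card {m \<in> chain_monomials V. monomial_degree m = n}"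
proof -
  let ?S = "{m \<in> chain_monomials V. monomial_degree m = n}"
  have fin: "finite ?S"
    by (rule finite_subset[OF _ finite_chain_monomials[of n]]) auto
  obtain ms where ms: "distinct ms" "set ms = ?S"
    using finite_distinct_list[OF fin] by blast
  have car: "p \<in> homogeneous_polys V n" if "keys p \<subseteq> ?S" for p :: "(real \<times> real, 'k) mpoly"
    using that by (fastforce simp: homogeneous_polys_def carrier_poly_ring chain_monomials_def)
  have "cls ` homogeneous_polys V n = cls ` {p. keys p \<subseteq> set ms}"
  proof
    show "cls ` {p. keys p \<subseteq> set ms} \<subseteq> cls ` homogeneous_polys V n"
      using car ms(2) by auto
    show "cls ` homogeneous_polys V n \<subseteq> cls ` {p. keys p \<subseteq> set ms}"
    proof
      fix x assume "x \<in> cls ` homogeneous_polys V n"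
      then obtain p where p: "x = cls p" "p \<in> carrier P" "\<forall>m\<in>keys p. monomial_degree m = n"
        by (auto simp: homogeneous_polys_def)
      obtain q where q: "keys q \<subseteq> chain_monomials V" "monomial_degree ` keys q \<subseteq> monomial_degree ` keys p" "p - q \<in> I"
        using normal_form[OF p(2)] by blast
      have "keys q \<subseteq> ?S" using q p(3) by fastforce
      moreover from car[OF this] have "q \<in> carrier P" by (simp add: homogeneous_polys_def)
      then have "x = cls q" using cls_eq_iff[OF p(2)] q(3) p(1) by simp
      ultimately show "x \<in> cls ` {p. keys p \<subseteq> set ms}" using ms(2) by simp
    qed
  qed
  then show ?thesis
    using ring.dimI[OF ring_A subfield_cls_constants dimension_chain_monomials[OF ms(1)]] ms distinct_card[OF ms(1)]
    by (simp add: over_def)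
qed

subsection \<open>Krull dimension\<close>

text \<open>An ideal above \<open>I\<close> is a union of cosets. This is the basis for moving prime
  ideals between the polynomial ring and the quotient.\<close>

lemma cls_mem_image_iff:
  assumes J: "ideal J P" "I \<subseteq> J" and p: "p \<in> carrier P"
  shows "cls p \<in> cls ` J \<longleftrightarrow> p \<in> J"
proof
  assume "cls p \<in> cls ` J"
  then obtain j where j: "j \<in> J" "cls p = cls j" by auto
  then have "p - j \<in> J" using cls_eq_iff[OF p] J ideal_poly_ringD(1)[OF J(1)] by blast
  then show "p \<in> J" using ideal_poly_ringD(3)[OF J(1) _ j(1)] by force
qed simp

lemma primeideal_image:
  assumes J: "primeideal J P" "I \<subseteq> J"
  shows "primeideal (cls ` J) A"
proof (rule primeidealI)
  interpret J: primeideal J P by fact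
  show id: "ideal (cls ` J) A"
    using poly_ring.ring_ideal_imp_quot_ideal[OF ideal_I J.is_ideal] .
  show "cring A" by (rule cring_A)
  have "1 \<notin> J" using J.one_imp_carrier J.I_notcarr by auto
  then show "carrier A \<noteq> cls ` J"
    using cls_mem_image_iff[OF J.is_ideal J(2), of 1] cls_closed[of 1] by auto
  fix a b assume ab: "a \<in> carrier A" "b \<in> carrier A" "a \<otimes>\<^bsub>A\<^esub> b \<in> cls ` J"
  then obtain p q where pq: "p \<in> carrier P" "a = cls p" "q \<in> carrier P" "b = cls q"
    using carrier_A by meson
  then have "p * q \<in> J"
    using ab(3) cls_mem_image_iff[OF J.is_ideal J(2), of "p * q"] by (simp add: cls_mult poly_ring_closed)
  then have "p \<in> J \<or> q \<in> J" using J.I_prime pq by simp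
  then show "a \<in> cls ` J \<or> b \<in> cls ` J" using pq by auto
qed

lemma primeideal_vimage:
  assumes Q: "primeideal Q A"
  shows "primeideal {p \<in> carrier P. cls p \<in> Q} P" "I \<subseteq> {p \<in> carrier P. cls p \<in> Q}"
proof -
  interpret Q: primeideal Q A by fact
  show "primeideal {p \<in> carrier P. cls p \<in> Q} P"
  proof (rule primeidealI)
    show "ideal {p \<in> carrier P. cls p \<in> Q} P"
      using ring_hom_ring.ideal_vimage[OF cls_hom Q.is_ideal] .
    show "cring P" by (rule cring_poly_ring)
    have "cls 1 \<notin> Q" using Q.one_imp_carrier Q.I_notcarr by (auto simp: cls_one)
    then show "carrier P \<noteq> {p \<in> carrier P. cls p \<in> Q}" using poly_ring_closed(2) by blast
    fix a b assume "a \<in> carrier P" "b \<in> carrier P" "a \<otimes>\<^bsub>P\<^esub> b \<in> {p \<in> carrier P. cls p \<in> Q}"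
    then show "a \<in> {p \<in> carrier P. cls p \<in> Q} \<or> b \<in> {p \<in> carrier P. cls p \<in> Q}"
      using Q.I_prime[OF cls_closed cls_closed, of a b] by (auto simp: cls_mult)
  qed
  show "I \<subseteq> {p \<in> carrier P. cls p \<in> Q}"
  proof
    fix p assume p: "p \<in> I"
    then have "p \<in> carrier P" using I_closed(1) by blast
    then show "p \<in> {p \<in> carrier P. cls p \<in> Q}"
      using cls_eq_zero_iff[of p] p Q.zero_closed by simp
  qed
qed

end

lemma chain_enumeration:
  fixes C :: "'a::order set"
  assumes "finite C" "Complete_Partial_Order.chain (\<le>) C"
  shows "\<exists>f. (\<forall>i<card C. f i \<in> C) \<and> (\<forall>i j. i < j \<and> j < card C \<longrightarrow> f i < f j)"
  using assms
proof (induction "card C" arbitrary: C)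
  case (Suc n)
  then have "C \<noteq> {}" by auto
  then obtain a where a: "a \<in> C" "\<And>x. x \<in> C \<Longrightarrow> x \<le> a"
    using finite_has_maximal[of C] Suc.prems unfolding chain_def by metis
  have card: "card (C - {a}) = n" using Suc.hyps(2) a(1) Suc.prems(1) by simp
  then obtain f where f: "\<forall>i<n. f i \<in> C - {a}" "\<forall>i j. i < j \<and> j < n \<longrightarrow> f i < f j"
    using Suc.hyps(1)[of "C - {a}"] Suc.prems by (auto simp: chain_def)
  have "(\<forall>i<Suc n. (f(n := a)) i \<in> C) \<and> (\<forall>i j. i < j \<and> j < Suc n \<longrightarrow> (f(n := a)) i < (f(n := a)) j)"
    using f a by (auto simp: less_Suc_eq order.strict_iff_order)
  then show ?case using Suc.hyps(2) by metis
qed simp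

section \<open>Growth forced by a chain of primes\<close>

definition degree_le :: "nat \<Rightarrow> ('v, 'k::field) mpoly \<Rightarrow> bool" where
  "degree_le N p \<longleftrightarrow> (\<forall>m\<in>keys p. monomial_degree m \<le> N)"

lemma degree_le_mono: "degree_le M p \<Longrightarrow> M \<le> N \<Longrightarrow> degree_le N p"
  by (auto simp: degree_le_def intro: order.trans)

lemma degree_le_one: "degree_le N 1"
  by (auto simp: degree_le_def)

lemma degree_le_mult: "degree_le M p \<Longrightarrow> degree_le N q \<Longrightarrow> degree_le (M + N) (p * q)"
  using keys_mult[of p q] by (fastforce simp: degree_le_def monomial_degree_add intro: add_mono)

lemma degree_le_power: "degree_le N p \<Longrightarrow> degree_le (i * N) (p ^ i)"
  by (induction i) (auto simp: degree_le_one intro: degree_le_mult)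

lemma degree_le_exists: "\<exists>N. degree_le N p"
  unfolding degree_le_def by (rule exI[of _ "Max (monomial_degree ` keys p)"]) auto

lemma degree_le_common:
  assumes "finite J" shows "\<exists>N. \<forall>i\<in>J. degree_le N (f i)"
proof -
  define g where "g i = (SOME N. degree_le N (f i))" for i
  have g: "degree_le (g i) (f i)" for i
    unfolding g_def using degree_le_exists by (rule someI_ex)
  have "degree_le (Max (g ` J)) (f i)" if "i \<in> J" for i
    by (rule degree_le_mono[OF g]) (use that assms in auto)
  then show ?thesis by blast
qed

text \<open>Coefficients belong to indices and not to values, so a repeated value counts as a
  dependence and \<open>card S\<close> really counts elements.\<close>

definition independent_mod ::
    "'v set \<Rightarrow> ('v, 'k::field) mpoly set \<Rightarrow> 'i set \<Rightarrow> ('i \<Rightarrow> ('v, 'k) mpoly) \<Rightarrow> bool" where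
  "independent_mod V J S g \<longleftrightarrow> finite S \<and> g ` S \<subseteq> carrier (poly_ring V) \<and>
     (\<forall>c. (\<Sum>i\<in>S. single 0 (c i) * g i) \<in> J \<longrightarrow> (\<forall>i\<in>S. c i = 0))"

text \<open>Modulo \<open>J'\<close> only the term \<open>h 0\<close> survives, as \<open>f\<close>
  lies in \<open>J'\<close>; so \<open>h 0\<close> vanishes. Primality of \<open>J\<close> then
  cancels one factor \<open>f\<close>, and the shorter sum is treated in the same way.\<close>

lemma power_sum_in_primeideal:
  fixes J :: "('v, 'k::field) mpoly set"
  assumes J: "primeideal J (poly_ring V)" and J': "ideal J' (poly_ring V)" "J \<subseteq> J'" and f: "f \<in> J'" "f \<notin> J"
    and h: "\<And>i. h i \<in> carrier (poly_ring V)" "\<And>i. h i \<in> J' \<Longrightarrow> h i = 0"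
    and sum: "(\<Sum>i\<le>n. f ^ i * h i) \<in> J"
  shows "\<forall>i\<le>n. h i = 0"
  using h sum
proof (induction n arbitrary: h)
  case 0
  then show ?case using J'(2) by auto
next
  case (Suc n)
  let ?s = "\<Sum>i\<le>n. f ^ i * h (Suc i)"
  have fc: "f \<in> carrier (poly_ring V)" using f(1) ideal_poly_ringD(1)[OF J'(1)] by blast
  then have s: "?s \<in> carrier (poly_ring V)"
    using Suc.prems(1) by (intro poly_ring_sum_closed poly_ring_closed poly_ring_power_closed) auto
  have eq: "(\<Sum>i\<le>Suc n. f ^ i * h i) = h 0 + f * ?s"
    by (subst sum.atMost_Suc_shift) (simp add: sum_distrib_left mult.assoc)
  then have "h 0 + f * ?s \<in> J'" using Suc.prems(3) J'(2) by auto
  moreover have "f * ?s \<in> J'" using ideal_poly_ringD(4)[OF J'(1) f(1) s] by (simp add: mult.commute)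
  ultimately have "h 0 \<in> J'" using ideal_poly_ringD(6)[OF J'(1), of "h 0 + f * ?s" "f * ?s"] by simp
  then have h0: "h 0 = 0" using Suc.prems(2) by blast
  then have "f * ?s \<in> J" using Suc.prems(3) eq by simp
  then have "?s \<in> J" using primeideal.I_prime[OF J fc s] f(2) by simp
  then have "\<forall>i\<le>n. h (Suc i) = 0" using Suc.IH[of "\<lambda>i. h (Suc i)"] Suc.prems(1,2) by blast
  then show ?case using h0 by (metis Suc_le_mono not0_implies_Suc)
qed

text \<open>Passing down to a smaller prime multiplies the family by the powers
  \<open>f ^ 0, ..., f ^ n\<close>. Collecting a relation by powers of \<open>f\<close> leaves
  combinations of \<open>g\<close>, each of which is zero once it lies in \<open>J'\<close>. The
  lists record the exponents chosen at the successive primes.\<close>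

lemma independent_mod_powers:
  fixes J :: "('v, 'k::field) mpoly set"
  assumes J: "primeideal J (poly_ring V)" and J': "ideal J' (poly_ring V)" "J \<subseteq> J'" and f: "f \<in> J'" "f \<notin> J"
    and g: "independent_mod V J' S g"
  shows "independent_mod V J ((\<lambda>(i, l). i # l) ` ({..n} \<times> S)) (\<lambda>l. f ^ hd l * g (tl l))"
  unfolding independent_mod_def
proof (intro conjI allI impI)
  have S: "finite S" and gc: "\<And>l. l \<in> S \<Longrightarrow> g l \<in> carrier (poly_ring V)"
    and ind: "\<And>c l. (\<Sum>l\<in>S. single 0 (c l) * g l) \<in> J' \<Longrightarrow> l \<in> S \<Longrightarrow> c l = 0"
    using g unfolding independent_mod_def by blast+
  let ?T = "(\<lambda>(i, l). i # l) ` ({..n} \<times> S)"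
  have fc: "f \<in> carrier (poly_ring V)" using f(1) ideal_poly_ringD(1)[OF J'(1)] by blast
  show "finite ?T" using S by simp
  show "(\<lambda>l. f ^ hd l * g (tl l)) ` ?T \<subseteq> carrier (poly_ring V)"
    using gc poly_ring_power_closed[OF fc] by auto
  fix c assume *: "(\<Sum>l\<in>?T. single 0 (c l) * (f ^ hd l * g (tl l))) \<in> J"
  define h where "h i = (\<Sum>l\<in>S. single 0 (c (i # l)) * g l)" for i
  have "(\<Sum>l\<in>?T. single 0 (c l) * (f ^ hd l * g (tl l))) = (\<Sum>(i, l)\<in>{..n} \<times> S. single 0 (c (i # l)) * (f ^ i * g l))"
    by (subst sum.reindex) (auto simp: inj_on_def intro!: sum.cong)
  also have "\<dots> = (\<Sum>i\<le>n. \<Sum>l\<in>S. single 0 (c (i # l)) * (f ^ i * g l))"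
    by (simp add: sum.cartesian_product)
  also have "\<dots> = (\<Sum>i\<le>n. f ^ i * h i)"
    unfolding h_def sum_distrib_left by (intro sum.cong refl) (simp add: algebra_simps)
  finally have sum: "(\<Sum>i\<le>n. f ^ i * h i) \<in> J" using * by simp
  have "h i \<in> carrier (poly_ring V)" for i
    unfolding h_def using gc by (intro poly_ring_sum_closed poly_ring_closed) auto
  moreover have hJ': "c (i # l) = 0" if "h i \<in> J'" "l \<in> S" for i l
    using ind[of "\<lambda>l. c (i # l)"] that unfolding h_def by blast
  moreover have "h i = 0" if "h i \<in> J'" for i
    unfolding h_def using hJ'[OF that] by (intro sum.neutral) simp
  ultimately have h0: "\<forall>i\<le>n. h i = 0"
    using power_sum_in_primeideal[OF J J' f _ _ sum] by blast
  show "\<forall>l\<in>?T. c l = 0"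
    using h0 hJ' ideal_poly_ringD(2)[OF J'(1)] by fastforce
qed

text \<open>
  A chain of primes of length \<open>D\<close> thus forces at least \<open>(n + 1)\<^sup>D\<close> independent elements of degree
  \<open>O(n)\<close>, so \<open>D\<close> cannot exceed the growth exponent of the ring.
\<close>

lemma independent_family_of_prime_chain:
  fixes J :: "nat \<Rightarrow> ('v, 'k::field) mpoly set"
  assumes "\<And>i. i \<le> D \<Longrightarrow> primeideal (J i) (poly_ring V)" "\<And>i. i < D \<Longrightarrow> J i \<subseteq> J (Suc i)"
    "\<And>i. i < D \<Longrightarrow> f i \<in> J (Suc i) - J i" "\<And>i. i < D \<Longrightarrow> degree_le s (f i)"
  shows "\<exists>g. independent_mod V (J 0) {l. length l = D \<and> set l \<subseteq> {..n}} g
     \<and> (\<forall>l. length l = D \<and> set l \<subseteq> {..n} \<longrightarrow> degree_le (D * n * s) (g l))"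
  using assms
proof (induction D arbitrary: J f)
  case 0
  have S: "{l. length l = 0 \<and> set l \<subseteq> {..n}} = {[]}" by auto
  interpret J: primeideal "J 0" "poly_ring V" using 0 by simp
  \<comment> \<open>A proper ideal contains no nonzero constant, so the family consisting of
    \<open>1\<close> alone is independent.\<close>
  have "1 \<notin> J 0" using J.one_imp_carrier J.I_notcarr by auto
  moreover have "1 \<in> J 0" if "single 0 c \<in> J 0" "c \<noteq> 0" for c
    using J.I_l_closed[OF that(1), of "single 0 (inverse c)", OF poly_ring_closed(7)] that(2) by (simp add: mult_single)
  ultimately have "independent_mod V (J 0) {[]} (\<lambda>_. 1)"
    by (auto simp: independent_mod_def)
  then show ?case unfolding S by (intro exI[of _ "\<lambda>_. 1"]) (auto simp: degree_le_one)
next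
  case (Suc D)
  let ?S = "{l. length l = D \<and> set l \<subseteq> {..n}}"
  \<comment> \<open>The induction treats the chain starting at \<open>J (Suc 0)\<close>, so the
    family grows from the largest prime downwards and \<open>f 0\<close> performs the last
    descent.\<close>
  obtain g where g: "independent_mod V (J (Suc 0)) ?S g" "\<And>l. l \<in> ?S \<Longrightarrow> degree_le (D * n * s) (g l)"
    using Suc.IH[of "\<lambda>i. J (Suc i)" "\<lambda>i. f (Suc i)"] Suc.prems by auto
  have S: "{l. length l = Suc D \<and> set l \<subseteq> {..n}} = (\<lambda>(i, l). i # l) ` ({..n} \<times> ?S)"
    by (auto simp: length_Suc_conv)
  have "independent_mod V (J 0) ((\<lambda>(i, l). i # l) ` ({..n} \<times> ?S)) (\<lambda>l. f 0 ^ hd l * g (tl l))"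
    using Suc.prems(3)[of 0]
    by (intro independent_mod_powers[OF Suc.prems(1) primeideal.axioms(1)[OF Suc.prems(1)] Suc.prems(2) _ _ g(1)]) auto
  moreover have "degree_le (Suc D * n * s) (f 0 ^ hd l * g (tl l))" if l: "length l = Suc D" "set l \<subseteq> {..n}" for l
  proof -
    obtain i l' where l': "l = i # l'" "i \<le> n" "l' \<in> ?S" using l by (cases l) auto
    have "degree_le (i * s + D * n * s) (f 0 ^ i * g l')"
      using g(2)[OF l'(3)] Suc.prems(4)[of 0] by (intro degree_le_mult degree_le_power) auto
    moreover have "i * s + D * n * s \<le> Suc D * n * s"
      using mult_le_mono1[OF l'(2), of s] by (simp add: algebra_simps)
    ultimately show ?thesis using l'(1) degree_le_mono by simp
  qed
  ultimately show ?case unfolding S by (intro exI[of _ "\<lambda>l. f 0 ^ hd l * g (tl l)"]) (auto simp: S[symmetric])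
qed

section \<open>Growth of the Hibi ring and bounds on chains of primes\<close>

context hibi
begin

text \<open>Sort by support: there are at most \<open>2 ^ card V\<close> supports, each a chain with
  at most \<open>d\<close> elements, and every exponent is at most \<open>N\<close>. Only the order
  of growth in \<open>N\<close> matters.\<close>

lemma card_chain_monomials_le:
  assumes d: "\<And>C. C \<subseteq> V \<Longrightarrow> Complete_Partial_Order.chain (\<le>) C \<Longrightarrow> card C \<le> d"
  shows "card {m \<in> chain_monomials V. monomial_degree m \<le> N} \<le> 2 ^ card V * (N + 1) ^ d"
proof -
  let ?S = "{m \<in> chain_monomials V. monomial_degree m \<le> N}"
  have "card ?S = (\<Sum>C\<in>Pow V. card {m \<in> ?S. keys m = C})"
  proof -
    have "(\<Sum>C\<in>Pow V. \<Sum>m\<in>{m \<in> ?S. keys m = C}. 1::nat) = (\<Sum>m\<in>?S. 1)"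
      using finite_chain_monomials finite_V by (intro sum.group) (auto simp: chain_monomials_def)
    then show ?thesis by simp
  qed
  also have "\<dots> \<le> (\<Sum>C\<in>Pow V. (N + 1) ^ d)"
  proof (rule sum_mono)
    fix C assume C: "C \<in> Pow V"
    let ?SC = "{m \<in> ?S. keys m = C}"
    show "card ?SC \<le> (N + 1) ^ d"
    proof (cases "?SC = {}")
      case True
      then show ?thesis by (metis card.empty le0)
    next
      case False
      then have "card C \<le> d" using C by (intro d) (auto simp: chain_monomials_def chain_def)
      have "finite C" using C finite_V finite_subset by auto
      have "card ?SC = card ((\<lambda>m. restrict (lookup m) C) ` ?SC)"
        by (rule card_image[symmetric], rule inj_on_subset[OF inj_on_restrict_lookup]) auto
      also have "\<dots> \<le> card (\<Pi>\<^sub>E v\<in>C. {..N})"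
        by (rule card_mono) (use \<open>finite C\<close> in \<open>auto intro: finite_PiE order.trans[OF lookup_le_monomial_degree]\<close>)
      also have "\<dots> = (N + 1) ^ card C" using \<open>finite C\<close> by (simp add: card_PiE)
      also have "\<dots> \<le> (N + 1) ^ d" using \<open>card C \<le> d\<close> by (intro power_increasing) auto
      finally show ?thesis .
    qed
  qed
  also have "\<dots> = 2 ^ card V * (N + 1) ^ d" using finite_V by (simp add: card_Pow)
  finally show ?thesis .
qed

text \<open>Since \<open>I\<close> is the toric kernel, the images of the family are linearly
  independent, and normal forms place them in the span of the images of the chain monomials of
  degree at most \<open>N\<close>.\<close>

lemma card_independent_mod_le:
  assumes g: "independent_mod V I S g" and deg: "\<And>i. i \<in> S \<Longrightarrow> degree_le N (g i)"
  shows "card S \<le> card {m \<in> chain_monomials V. monomial_degree m \<le> N}"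
proof -
  interpret T: vector_space "\<lambda>(c::'k) p :: (real, 'k) mpoly. single 0 c * p"
    by unfold_locales (auto simp: algebra_simps single_add mult_single[symmetric] mult.assoc[symmetric] mult_single)
  have S: "finite S" and gc: "\<And>l. l \<in> S \<Longrightarrow> g l \<in> carrier P"
    and ind: "\<And>c l. (\<Sum>l\<in>S. single 0 (c l) * g l) \<in> I \<Longrightarrow> l \<in> S \<Longrightarrow> c l = 0"
    using g unfolding independent_mod_def by blast+
  let ?M = "{m \<in> chain_monomials V. monomial_degree m \<le> N}"
  let ?f = "\<lambda>i. toric_map UNIV (g i) :: (real, 'k) mpoly"
  have ker: "p \<in> I" if "p \<in> carrier P" "toric_map UNIV p = 0" for p
    using that by (simp add: I_eq_toric_kernel toric_kernel_def)
  have inj: "inj_on ?f S"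
  proof (rule inj_onI, rule ccontr)
    fix i j assume ij: "i \<in> S" "j \<in> S" "?f i = ?f j" "i \<noteq> j"
    \<comment> \<open>Equal images would put \<open>g i - g j\<close> into the kernel, a relation
      with coefficients 1 and -1.\<close>
    let ?c = "\<lambda>l. if l = i then 1 else if l = j then - 1 else (0::'k)"
    have "(\<Sum>l\<in>S. single 0 (?c l) * g l) = (\<Sum>l\<in>{i, j}. single 0 (?c l) * g l)"
      using S ij by (intro sum.mono_neutral_right) auto
    also have "\<dots> = g i - g j" using ij(4) by (simp add: single_uminus)
    also have "\<dots> \<in> I" using ij gc by (intro ker) auto
    finally show False using ind[of ?c i] ij by auto
  qed
  have "T.independent (?f ` S)"
  proof (rule T.independent_if_scalars_zero)
    show "finite (?f ` S)" using S by simp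
    fix u x assume *: "(\<Sum>x\<in>?f ` S. single 0 (u x) * x) = 0" and x: "x \<in> ?f ` S"
    let ?p = "\<Sum>i\<in>S. single 0 (u (?f i)) * g i"
    have "toric_map UNIV ?p = (\<Sum>i\<in>S. single 0 (u (?f i)) * ?f i)" by simp
    also have "\<dots> = 0" using * by (simp add: sum.reindex[OF inj])
    finally have "toric_map UNIV ?p = 0" .
    moreover have "?p \<in> carrier P" using gc by (intro poly_ring_sum_closed poly_ring_closed) auto
    ultimately have "?p \<in> I" by (rule ker[rotated])
    then show "u x = 0" using ind[of "\<lambda>i. u (?f i)"] x by blast
  qed
  moreover have "?f ` S \<subseteq> T.span (toric_weight UNIV ` ?M)"
  proof
    fix x assume "x \<in> ?f ` S"
    then obtain i where i: "i \<in> S" "x = ?f i" by blast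
    obtain q where q: "keys q \<subseteq> chain_monomials V" "monomial_degree ` keys q \<subseteq> monomial_degree ` keys (g i)" "g i - q \<in> I"
      using normal_form[OF gc[OF i(1)]] by blast
    have sub: "keys q \<subseteq> ?M" using q(1,2) deg[OF i(1)] by (fastforce simp: degree_le_def)
    have "x = toric_map UNIV q" using toric_map_I[OF q(3)] i(2) by simp
    also have "\<dots> = (\<Sum>m\<in>keys q. single 0 (lookup q m) * toric_weight UNIV m)"
      by (simp add: toric_map_def linear_extension_def)
    also have "\<dots> \<in> T.span (toric_weight UNIV ` ?M)"
      using sub by (intro T.span_sum T.span_scale T.span_base) auto
    finally show "x \<in> T.span (toric_weight UNIV ` ?M)" .
  qed
  ultimately have "card (?f ` S) \<le> card (toric_weight UNIV ` ?M :: (real, 'k) mpoly set)"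
    using T.independent_span_bound finite_chain_monomials by blast
  also have "\<dots> \<le> card ?M" using finite_chain_monomials by (rule card_image_le)
  finally show ?thesis using card_image[OF inj] by simp
qed

end

lemma single_one_neq_zero: "single m (1 :: 'b::zero_neq_one) \<noteq> 0"
  by (metis lookup_single_eq lookup_zero zero_neq_one)

context hibi
begin

lemma prime_chain_length_le:
  assumes d: "\<And>C. C \<subseteq> V \<Longrightarrow> Complete_Partial_Order.chain (\<le>) C \<Longrightarrow> card C \<le> d"
    and Q: "\<And>i. i \<le> D \<Longrightarrow> primeideal (Q i) A" "\<And>i. i < D \<Longrightarrow> Q i \<subset> Q (Suc i)"
  shows "D \<le> d"
proof (rule ccontr)
  assume "\<not> D \<le> d"
  define J where "J i = {p \<in> carrier P. cls p \<in> Q i}" for i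
  have J: "primeideal (J i) P" if "i \<le> D" for i
    unfolding J_def using primeideal_vimage(1)[OF Q(1)[OF that]] .
  have I_J: "I \<subseteq> J 0" unfolding J_def using primeideal_vimage(2)[OF Q(1)] by simp
  have J_mono: "J i \<subseteq> J (Suc i)" if "i < D" for i
    using Q(2)[OF that] by (auto simp: J_def)
  have "\<exists>p. p \<in> J (Suc i) - J i" if i: "i < D" for i
  proof -
    obtain a where a: "a \<in> Q (Suc i)" "a \<notin> Q i" using Q(2)[OF i] by blast
    interpret Q': primeideal "Q (Suc i)" A using Q(1)[of "Suc i"] i by simp
    obtain p where "p \<in> carrier P" "a = cls p" using carrier_A[OF Q'.Icarr[OF a(1)]] by blast
    then show ?thesis using a by (auto simp: J_def)
  qed
  then obtain f where f: "\<And>i. i < D \<Longrightarrow> f i \<in> J (Suc i) - J i" by metis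
  obtain s where s: "\<forall>i\<in>{..<D}. degree_le s (f i)" using degree_le_common[of "{..<D}" f] by blast
  \<comment> \<open>Chosen so that the upper bound on \<open>card ?S\<close> becomes
    \<open>n * (n + 1) ^ d\<close>, while \<open>D > d\<close> makes \<open>card ?S\<close> at least
    \<open>(n + 1) ^ Suc d\<close>.\<close>
  define n where "n = 2 ^ card V * (D * s + 1) ^ d"
  let ?S = "{l. length l = D \<and> set l \<subseteq> {..n}}"
  obtain g where g: "independent_mod V (J 0) ?S g" "\<And>l. l \<in> ?S \<Longrightarrow> degree_le (D * n * s) (g l)"
    using independent_family_of_prime_chain[of D J V f s n] J J_mono f s by auto
  have "independent_mod V I ?S g"
    using g(1) I_J unfolding independent_mod_def by blast
  then have "card ?S \<le> 2 ^ card V * (D * n * s + 1) ^ d"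
    using card_independent_mod_le[of ?S g "D * n * s", OF _ g(2)] card_chain_monomials_le[OF d, of "D * n * s"] by linarith
  moreover have "card ?S = (n + 1) ^ D"
    using card_lists_length_eq[of "{..n}" D] by (simp add: conj_commute)
  moreover have "(n + 1) ^ Suc d \<le> (n + 1) ^ D"
    using \<open>\<not> D \<le> d\<close> by (intro power_increasing) auto
  moreover have "D * n * s + 1 \<le> (D * s + 1) * (n + 1)" by (simp add: algebra_simps)
  then have "(D * n * s + 1) ^ d \<le> (D * s + 1) ^ d * (n + 1) ^ d"
    by (metis power_mono power_mult_distrib zero_le)
  then have "2 ^ card V * (D * n * s + 1) ^ d \<le> 2 ^ card V * ((D * s + 1) ^ d * (n + 1) ^ d)"
    by (rule mult_le_mono2)
  ultimately have "(n + 1) ^ Suc d \<le> 2 ^ card V * ((D * s + 1) ^ d * (n + 1) ^ d)"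
    by (metis le_trans)
  also have "\<dots> = n * (n + 1) ^ d" by (simp add: n_def)
  finally show False by simp
qed

text \<open>
  The primes are the kernels of the toric maps that kill all variables not below a given member of
  the chain, followed by the ideal of all variables.
\<close>

lemma prime_chain_exists:
  assumes C: "C \<subseteq> V" "Complete_Partial_Order.chain (\<le>) C"
  shows "\<exists>Q. (\<forall>i\<le>card C. primeideal (Q i) A) \<and> (\<forall>i<card C. Q i \<subset> Q (Suc i))"
proof -
  let ?d = "card C"
  obtain f where f: "\<And>i. i < ?d \<Longrightarrow> f i \<in> C" "\<And>i j. i < j \<Longrightarrow> j < ?d \<Longrightarrow> f i < f j"
    using chain_enumeration[of C] C finite_subset[OF C(1) finite_V] by metis
  \<comment> \<open>The chain is traversed from its top, because kernels grow as \<open>D\<close>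
    shrinks. The empty set, used from the index \<open>card C\<close> on, kills every
    variable.\<close>
  define D where "D i = (if i < ?d then {v. v \<le> f (?d - 1 - i)} else {})" for i
  have fV: "f (?d - 1 - i) \<in> V" if "i < ?d" for i using f(1)[of "?d - 1 - i"] C(1) that by auto
  have prime: "primeideal (toric_kernel V (D i)) P" for i by (rule primeideal_toric_kernel)
  \<comment> \<open>A principal down-set is a product of two half-lines, so containing two opposite
    corners depends only on the coordinates that occur.\<close>
  have "{a, b} \<subseteq> D i \<longleftrightarrow> {(fst b, snd a), (fst a, snd b)} \<subseteq> D i" if "a \<le> b" for a b i
    using that by (auto simp: D_def less_eq_prod_def)
  then have I_sub: "I \<subseteq> toric_kernel V (D i)" for i by (rule I_subset_toric_kernel)
  have D_mono: "D (Suc i) \<subseteq> D i" if "i < ?d" for i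
  proof (cases "Suc i < ?d")
    case True
    then have "f (?d - 1 - Suc i) < f (?d - 1 - i)" by (intro f(2)) auto
    then show ?thesis using True by (auto simp: D_def intro: order.trans dest: less_imp_le)
  qed (simp add: D_def)
  have strict: "toric_kernel V (D i) \<subset> (toric_kernel V (D (Suc i)) :: (real \<times> real, 'k) mpoly set)" if i: "i < ?d" for i
  proof -
    let ?c = "f (?d - 1 - i)"
    have "toric_kernel V (D i) \<subseteq> (toric_kernel V (D (Suc i)) :: (real \<times> real, 'k) mpoly set)"
    proof (cases "Suc i < ?d")
      case True
      let ?c' = "f (?d - 1 - Suc i)"
      have c': "?c' \<in> V" using fV[OF True] .
      show ?thesis
      proof (rule toric_kernel_mono[OF D_mono[OF i]])
        fix m :: "real \<times> real \<Rightarrow>\<^sub>0 nat" assume m: "keys m \<subseteq> V"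
        \<comment> \<open>One interval tests both coordinates: the index of \<open>s\<close> is
          nonnegative and is bounded by the right end, the index of \<open>t\<close> is negative and
          is bounded by the left end.\<close>
        have *: "v \<le> ?c' \<longleftrightarrow> {fst v, - 1 - snd v} \<subseteq> {- 1 - snd ?c'..fst ?c'}" if "v \<in> V" for v
          using that c' V_nonneg by (auto simp: less_eq_prod_def)
        have "keys m \<subseteq> D (Suc i) \<longleftrightarrow> (\<forall>v\<in>keys m. v \<le> ?c')" using True by (auto simp: D_def)
        also have "\<dots> \<longleftrightarrow> (\<forall>v\<in>keys m. {fst v, - 1 - snd v} \<subseteq> {- 1 - snd ?c'..fst ?c'})"
          using * m by blast
        also have "\<dots> \<longleftrightarrow> keys (toric_exponent m) \<subseteq> {- 1 - snd ?c'..fst ?c'}"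
          unfolding keys_toric_exponent by blast
        finally show "keys m \<subseteq> D (Suc i) \<longleftrightarrow> keys (toric_exponent m) \<subseteq> {- 1 - snd ?c'..fst ?c'}" .
      qed
    next
      case False
      then show ?thesis
        by (intro toric_kernel_mono[OF D_mono[OF i], of V "{}"]) (auto simp: D_def keys_toric_exponent)
    qed
    \<comment> \<open>The variable at the chain element dropped in this step separates the two
      primes.\<close>
    moreover have "var ?c \<in> (toric_kernel V (D (Suc i)) :: (real \<times> real, 'k) mpoly set)" "var ?c \<notin> (toric_kernel V (D i) :: (real \<times> real, 'k) mpoly set)"
    proof -
      have "?c \<notin> D (Suc i)"
      proof (cases "Suc i < ?d")
        case True
        then have "f (?d - 1 - Suc i) < ?c" by (intro f(2)) auto
        then show ?thesis using True by (auto simp: D_def)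
      qed (simp add: D_def)
      then show "var ?c \<in> (toric_kernel V (D (Suc i)) :: (real \<times> real, 'k) mpoly set)"
        using fV[OF i] by (simp add: toric_kernel_def var_def toric_weight_def carrier_poly_ring)
      have "?c \<in> D i" using i by (simp add: D_def)
      then show "var ?c \<notin> (toric_kernel V (D i) :: (real \<times> real, 'k) mpoly set)"
        by (simp add: toric_kernel_def var_def toric_weight_def single_one_neq_zero)
    qed
    ultimately show ?thesis by blast
  qed
  define Q where "Q i = cls ` (toric_kernel V (D i) :: (real \<times> real, 'k) mpoly set)" for i
  have "Q i \<subset> Q (Suc i)" if i: "i < ?d" for i
  proof -
    obtain p where p: "p \<in> toric_kernel V (D (Suc i))" "p \<notin> (toric_kernel V (D i) :: (real \<times> real, 'k) mpoly set)"
      using strict[OF i] by blast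
    then have "p \<in> carrier P" by (simp add: toric_kernel_def)
    then have "cls p \<notin> Q i"
      unfolding Q_def using cls_mem_image_iff[OF primeideal.axioms(1)[OF prime] I_sub] p(2) by blast
    moreover have "cls p \<in> Q (Suc i)" using p(1) by (simp add: Q_def)
    moreover have "Q i \<subseteq> Q (Suc i)" using strict[OF i] by (auto simp: Q_def)
    ultimately show ?thesis by blast
  qed
  moreover have "primeideal (Q i) A" for i
    unfolding Q_def by (rule primeideal_image[OF prime I_sub])
  ultimately show ?thesis by blast
qed

lemma krull_dimension_A:
  assumes d: "\<And>C. C \<subseteq> V \<Longrightarrow> Complete_Partial_Order.chain (\<le>) C \<Longrightarrow> card C \<le> d"
    and C: "C \<subseteq> V" "Complete_Partial_Order.chain (\<le>) C" "card C = d"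
  shows "krull_dimension A = enat d"
  unfolding krull_dimension_def
proof (rule antisym)
  let ?S = "{n. \<exists>Q. (\<forall>i\<le>n. primeideal (Q i) A) \<and> (\<forall>i<n. Q i \<subset> Q (Suc i))}"
  show "(SUP n\<in>?S. enat n) \<le> enat d"
    using prime_chain_length_le[OF d] by (intro SUP_least) auto
  have "d \<in> ?S" using prime_chain_exists[of C] C by blast
  then show "enat d \<le> (SUP n\<in>?S. enat n)" by (rule SUP_upper)
qed

end

section \<open>Hilbert series\<close>

definition support_series :: "'v set \<Rightarrow> int fps" where
  "support_series C = Abs_fps (\<lambda>n. int (card {m :: 'v \<Rightarrow>\<^sub>0 nat. keys m = C \<and> monomial_degree m = n}))"

text \<open>
  The substance is the recursion \<open>(1 - X) * support_series (insert v C) = X * support_series C\<close>,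
  obtained by lowering the exponent of \<open>v\<close> by one.
\<close>

lemma support_series_eq:
  assumes "finite C"
  shows "(1 - fps_X) ^ card C * support_series C = fps_X ^ card C"
  using assms
proof (induction C rule: finite_induct)
  case empty
  have "{m :: 'a \<Rightarrow>\<^sub>0 nat. keys m = {} \<and> monomial_degree m = n} = (if n = 0 then {0} else {})" for n
    by auto
  then have "support_series ({} :: 'a set) = 1"
    unfolding support_series_def by (intro fps_ext) auto
  then show ?case by simp
next
  case (insert v C)
  let ?S = "\<lambda>C n. {m :: 'a \<Rightarrow>\<^sub>0 nat. keys m = C \<and> monomial_degree m = n}"
  have fin: "finite (?S D n)" if "finite D" for D n
    by (rule finite_subset[OF _ finite_monomials_le[OF that, of n]]) auto
  have rec: "?S (insert v C) (Suc n) = (\<lambda>m. single v 1 + m) ` (?S (insert v C) n \<union> ?S C n)" for n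
  proof (intro equalityI subsetI)
    fix m assume m: "m \<in> ?S (insert v C) (Suc n)"
    then obtain r where r: "m = single v 1 + r" using split_single[of v m] by auto
    then have "insert v (keys r) = insert v C" "monomial_degree r = n"
      using m by (auto simp: keys_add_nat monomial_degree_add)
    then have "keys r = insert v C \<or> keys r = C" using insert.hyps(2) by (metis insert_absorb insert_ident)
    then have "r \<in> ?S (insert v C) n \<union> ?S C n" using \<open>monomial_degree r = n\<close> by blast
    then show "m \<in> (\<lambda>m. single v 1 + m) ` (?S (insert v C) n \<union> ?S C n)"
      unfolding r by (rule imageI)
  next
    fix m assume "m \<in> (\<lambda>m. single v 1 + m) ` (?S (insert v C) n \<union> ?S C n)"
    then obtain r where "m = single v 1 + r" "keys r = insert v C \<or> keys r = C" "monomial_degree r = n" by blast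
    then show "m \<in> ?S (insert v C) (Suc n)" by (auto simp: keys_add_nat monomial_degree_add)
  qed
  have "card (?S (insert v C) (Suc n)) = card (?S (insert v C) n \<union> ?S C n)" for n
    unfolding rec by (rule card_image) (auto simp: inj_on_def)
  also have "card (?S (insert v C) n \<union> ?S C n) = card (?S (insert v C) n) + card (?S C n)" for n
    using insert.hyps fin[of "insert v C" n] fin[of C n] by (intro card_Un_disjoint) auto
  finally have Suc: "card (?S (insert v C) (Suc n)) = card (?S (insert v C) n) + card (?S C n)" for n .
  have "?S (insert v C) 0 = {}" by (auto simp: monomial_degree_eq_0_iff)
  then have zero: "card (?S (insert v C) 0) = 0" by (simp only: card.empty)
  have "support_series (insert v C) = fps_X * (support_series (insert v C) + support_series C)"
  proof (rule fps_ext)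
    fix n
    show "fps_nth (support_series (insert v C)) n = fps_nth (fps_X * (support_series (insert v C) + support_series C)) n"
      using Suc zero by (cases n) (simp_all add: support_series_def)
  qed
  then have "(1 - fps_X) * support_series (insert v C) = fps_X * support_series C"
    by (simp add: algebra_simps)
  then have "(1 - fps_X) ^ card (insert v C) * support_series (insert v C)
      = fps_X * ((1 - fps_X) ^ card C * support_series C)"
    using insert.hyps by (simp add: mult.assoc mult.left_commute)
  then show ?case using insert by simp
qed

definition chain_sets :: "'v::order set \<Rightarrow> 'v set set" where
  "chain_sets V = {C. C \<subseteq> V \<and> Complete_Partial_Order.chain (\<le>) C}"

text \<open>\<open>[:1, - 1:]\<close> is \<open>1 - t\<close>. The truncated subtraction in the
  exponent is faithful as long as no chain has more than \<open>d\<close> elements.\<close>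

definition chain_polynomial :: "nat \<Rightarrow> 'v::order set \<Rightarrow> int poly" where
  "chain_polynomial d V = (\<Sum>C\<in>chain_sets V. Polynomial.monom 1 (card C) * [:1, - 1:] ^ (d - card C))"

lemma chain_pairs:
  "chain_sets V \<inter> {C. card C = 2} = (\<lambda>(u, v). {u, v}) ` {(u, v) \<in> V \<times> V. u < v}"
proof (intro equalityI subsetI)
  fix C assume "C \<in> chain_sets V \<inter> {C. card C = 2}"
  then obtain x y where "C = {x, y}" "x \<noteq> y" "x \<in> V" "y \<in> V" "x \<le> y \<or> y \<le> x"
    by (auto simp: chain_sets_def chain_def card_2_iff)
  then have "C = {x, y} \<and> x < y \<or> C = {y, x} \<and> y < x" by auto
  then show "C \<in> (\<lambda>(u, v). {u, v}) ` {(u, v) \<in> V \<times> V. u < v}"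
    using \<open>x \<in> V\<close> \<open>y \<in> V\<close> by force
next
  fix C assume "C \<in> (\<lambda>(u, v). {u, v}) ` {(u, v) \<in> V \<times> V. u < v}"
  then show "C \<in> chain_sets V \<inter> {C. card C = 2}"
    by (auto simp: chain_sets_def chain_def card_insert_if)
qed

lemma coeff_one_minus_power:
  "poly.coeff ([:1, - 1:] ^ n) i = of_nat (n choose i) * (- 1 :: 'a::comm_ring_1) ^ i"
proof (cases "i \<le> n")
  case True
  then show ?thesis by (simp add: coeff_linear_poly_power)
next
  case False
  have "Polynomial.degree ([:1, - 1 :: 'a:] ^ n) \<le> n"
    by (rule order.trans[OF degree_power_le]) simp
  then show ?thesis using False by (simp add: coeff_eq_0 binomial_eq_0)
qed

text \<open>Only chains with at most two elements reach degree 2: a chain with \<open>j\<close>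
  elements contributes the coefficient of \<open>t ^ (2 - j)\<close> in
  \<open>(1 - t) ^ (d - j)\<close>. The singletons contribute \<open>- (d - 1)\<close> each.\<close>

lemma coeff_chain_polynomial_2:
  assumes V: "finite V" and d: "d \<ge> 1"
  shows "poly.coeff (chain_polynomial d V) 2 =
     int (d choose 2) - (int d - 1) * int (card V) + int (card {(u, v) \<in> V \<times> V. u < v})"
proof -
  let ?g = "\<lambda>j. if 2 < j then 0 else int (d - j choose (2 - j)) * (- 1) ^ (2 - j)"
  have fin: "finite (chain_sets V)" using V by (auto simp: chain_sets_def)
  have "poly.coeff (chain_polynomial d V) 2 = (\<Sum>C\<in>chain_sets V. ?g (card C))"
    unfolding chain_polynomial_def coeff_sum
    by (intro sum.cong refl) (auto simp: coeff_monom_mult coeff_one_minus_power not_less)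
  also have "\<dots> = (\<Sum>C\<in>chain_sets V \<inter> {C. card C \<le> 2}. ?g (card C))"
    using fin by (intro sum.mono_neutral_right) auto
  also have "\<dots> = (\<Sum>j\<in>{0,1,2}. \<Sum>C\<in>{C \<in> chain_sets V \<inter> {C. card C \<le> 2}. card C = j}. ?g (card C))"
    using fin by (intro sum.group[symmetric]) (auto simp: le_Suc_eq numeral_2_eq_2)
  also have "\<dots> = (\<Sum>j\<in>{0,1,2}. int (card (chain_sets V \<inter> {C. card C = j})) * ?g j)"
  proof (intro sum.cong refl)
    fix j :: nat assume "j \<in> {0,1,2}"
    then have "{C \<in> chain_sets V \<inter> {C. card C \<le> 2}. card C = j} = chain_sets V \<inter> {C. card C = j}" by auto
    then show "(\<Sum>C\<in>{C \<in> chain_sets V \<inter> {C. card C \<le> 2}. card C = j}. ?g (card C))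
        = int (card (chain_sets V \<inter> {C. card C = j})) * ?g j" by simp
  qed
  also have "\<dots> = int (card (chain_sets V \<inter> {C. card C = 0})) * int (d choose 2)
      - int (card (chain_sets V \<inter> {C. card C = 1})) * (int d - 1) + int (card (chain_sets V \<inter> {C. card C = 2}))"
    using d by (simp add: algebra_simps)
  also have "chain_sets V \<inter> {C. card C = 0} = {{}}"
  proof -
    have "C = {}" if "C \<subseteq> V" "card C = 0" for C
      using that finite_subset[OF that(1) V] by simp
    then show ?thesis by (auto simp: chain_sets_def chain_def)
  qed
  also have "chain_sets V \<inter> {C. card C = 1} = (\<lambda>v. {v}) ` V"
    by (auto simp: chain_sets_def chain_def card_1_singleton_iff)
  also have "card ((\<lambda>v. {v}) ` V) = card V" by (intro card_image) auto
  also have "card (chain_sets V \<inter> {C. card C = 2}) = card {(u, v) \<in> V \<times> V. u < v}"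
    unfolding chain_pairs by (intro card_image) (auto simp: inj_on_def doubleton_eq_iff)
  finally show ?thesis by simp
qed

context hibi
begin

text \<open>The supports of the chain monomials are the chains, so the series splits into
  \<open>support_series\<close> over all of them; the factor \<open>(1 - X) ^ d\<close> clears every
  denominator.\<close>

lemma hilbert_series_A:
  assumes d: "\<And>C. C \<in> chain_sets V \<Longrightarrow> card C \<le> d"
  shows "hilbert_series A (cls ` constants) (\<lambda>n. cls ` homogeneous_polys V n) * (1 - fps_X) ^ d
    = fps_of_poly (chain_polynomial d V)"
proof -
  have finC: "finite C" if "C \<in> chain_sets V" for C
    using that finite_V finite_subset by (auto simp: chain_sets_def)
  have fin: "finite (chain_sets V)" using finite_V by (auto simp: chain_sets_def)
  have "hilbert_series A (cls ` constants) (\<lambda>n. cls ` homogeneous_polys V n) = (\<Sum>C\<in>chain_sets V. support_series C)"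
  proof (rule fps_ext)
    fix n
    let ?S = "{m \<in> chain_monomials V. monomial_degree m = n}"
    have finS: "finite ?S" by (rule finite_subset[OF _ finite_chain_monomials[of n]]) auto
    have "int (card ?S) = (\<Sum>C\<in>chain_sets V. \<Sum>m\<in>{m \<in> ?S. keys m = C}. 1)"
      using finS fin by (subst sum.group) (auto simp: chain_monomials_def chain_sets_def chain_def)
    also have "\<dots> = (\<Sum>C\<in>chain_sets V. fps_nth (support_series C) n)"
    proof (intro sum.cong refl)
      fix C assume "C \<in> chain_sets V"
      then have "{m \<in> ?S. keys m = C} = {m. keys m = C \<and> monomial_degree m = n}"
        by (auto simp: chain_monomials_def chain_sets_def chain_def)
      then show "(\<Sum>m\<in>{m \<in> ?S. keys m = C}. 1) = fps_nth (support_series C) n"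
        by (simp add: support_series_def)
    qed
    finally show "fps_nth (hilbert_series A (cls ` constants) (\<lambda>n. cls ` homogeneous_polys V n)) n
        = fps_nth (\<Sum>C\<in>chain_sets V. support_series C) n"
      by (simp add: hilbert_series_def dim_homogeneous fps_sum_nth)
  qed
  then have "hilbert_series A (cls ` constants) (\<lambda>n. cls ` homogeneous_polys V n) * (1 - fps_X) ^ d
      = (\<Sum>C\<in>chain_sets V. support_series C * (1 - fps_X) ^ d)"
    by (simp add: sum_distrib_right)
  also have "\<dots> = (\<Sum>C\<in>chain_sets V. fps_X ^ card C * (1 - fps_X) ^ (d - card C))"
  proof (intro sum.cong refl)
    fix C assume C: "C \<in> chain_sets V"
    have "(1 - fps_X) ^ d = (1 - fps_X :: int fps) ^ card C * (1 - fps_X) ^ (d - card C)"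
      using d[OF C] by (simp add: power_add[symmetric])
    then have "support_series C * (1 - fps_X) ^ d = ((1 - fps_X) ^ card C * support_series C) * (1 - fps_X) ^ (d - card C)"
      by (simp add: mult_ac)
    then show "support_series C * (1 - fps_X) ^ d = fps_X ^ card C * (1 - fps_X) ^ (d - card C)"
      using support_series_eq[OF finC[OF C]] by simp
  qed
  also have "\<dots> = fps_of_poly (chain_polynomial d V)"
    unfolding chain_polynomial_def
    by (simp add: fps_of_poly_sum fps_of_poly_mult fps_of_poly_power fps_of_poly_monom fps_of_poly_pCons
        flip: fps_const_neg)
  finally show ?thesis .
qed

end

section \<open>Comparison of the coefficients\<close>

text \<open>The definite description is unique because the Krull dimension fixes the exponent and
  polynomials embed into power series.\<close>

lemma (in hibi) h_polynomial_A:
  assumes d: "\<And>C. C \<in> chain_sets V \<Longrightarrow> card C \<le> d" and C: "C \<in> chain_sets V" "card C = d"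
  shows "h_polynomial A (cls ` constants) (\<lambda>n. cls ` homogeneous_polys V n) = chain_polynomial d V"
proof -
  have krull: "krull_dimension A = enat d"
    using d C by (intro krull_dimension_A[of d C]) (auto simp: chain_sets_def)
  show ?thesis
    unfolding h_polynomial_def
  proof (rule the_equality)
    show "\<exists>d'. krull_dimension A = enat d' \<and>
        hilbert_series A (cls ` constants) (\<lambda>n. cls ` homogeneous_polys V n) * (1 - fps_X) ^ d' = fps_of_poly (chain_polynomial d V)"
      using krull hilbert_series_A[OF d] by blast
    fix h assume "\<exists>d'. krull_dimension A = enat d' \<and>
        hilbert_series A (cls ` constants) (\<lambda>n. cls ` homogeneous_polys V n) * (1 - fps_X) ^ d' = fps_of_poly h"
    then have "fps_of_poly h = fps_of_poly (chain_polynomial d V)"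
      using krull hilbert_series_A[OF d] by auto
    then show "h = chain_polynomial d V" by (simp only: fps_of_poly_eq_iff)
  qed
qed

section \<open>Bounds and longest chains of a planar lattice\<close>

context planar_lattice
begin

lemma bounds_exist:
  assumes "L \<noteq> {}"
  obtains b t where "b \<in> L" "t \<in> L" "\<And>v. v \<in> L \<Longrightarrow> b \<le> v \<and> v \<le> t"
proof -
  obtain b where b: "b \<in> L" "\<And>v. v \<in> L \<Longrightarrow> v \<le> b \<Longrightarrow> v = b"
    using finite_has_minimal[OF finite_L assms] by metis
  obtain t where t: "t \<in> L" "\<And>v. v \<in> L \<Longrightarrow> t \<le> v \<Longrightarrow> v = t"
    using finite_has_maximal[OF finite_L assms] by metis
  have "b \<le> v \<and> v \<le> t" if "v \<in> L" for v
    using b(2)[OF inf_closed[OF b(1) that]] t(2)[OF sup_closed[OF t(1) that]]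
    by (metis inf_le1 inf_le2 sup_ge1 sup_ge2)
  then show ?thesis using that b(1) t(1) by blast
qed

lemma card_chain_le:
  assumes "\<And>v. v \<in> L \<Longrightarrow> b \<le> v \<and> v \<le> t" "C \<subseteq> L" "Complete_Partial_Order.chain (\<le>) C"
  shows "card C \<le> nat (coord_sum t - coord_sum b + 1)"
proof -
  have "inj_on coord_sum C"
  proof (rule inj_onI, rule ccontr)
    fix x y assume "x \<in> C" "y \<in> C" "coord_sum x = coord_sum y" "x \<noteq> y"
    then show False
      using assms(3) coord_sum_strict_mono[of x y] coord_sum_strict_mono[of y x]
      by (auto simp: chain_def order.strict_iff_order)
  qed
  moreover have "coord_sum ` C \<subseteq> {coord_sum b..coord_sum t}"
  proof
    fix r assume "r \<in> coord_sum ` C"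
    then obtain v where "v \<in> L" "r = coord_sum v" using assms(2) by blast
    then show "r \<in> {coord_sum b..coord_sum t}" using assms(1)[of v] coord_sum_mono by simp
  qed
  ultimately show ?thesis
    using card_mono[of "{coord_sum b..coord_sum t}" "coord_sum ` C"] by (simp add: card_image)
qed

lemma maximal_chain_exists:
  assumes "b \<in> L" "t \<in> L" "b \<le> t"
  shows "\<exists>C\<subseteq>L. Complete_Partial_Order.chain (\<le>) C \<and> nat (coord_sum t - coord_sum b + 1) \<le> card C"
proof -
  obtain C where C: "C \<subseteq> L" "\<forall>x\<in>C. \<forall>y\<in>C. x \<le> y \<or> y \<le> x" "coord_sum ` C = {coord_sum b..coord_sum t}"
    using saturated_chain[OF assms] by blast
  have "finite C" using C(1) finite_L finite_subset by blast
  then have "card (coord_sum ` C) \<le> card C" by (rule card_image_le)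
  then show ?thesis using C by (intro exI[of _ C]) (auto simp: chain_def)
qed

end

text \<open>Counting takes place on integer points, whereas the variables of the ring are indexed by
  real ones; this order embedding transports chains and their sizes.\<close>

definition real_point :: "int \<times> int \<Rightarrow> real \<times> real" where
  "real_point = (\<lambda>(a, b). (real_of_int a, real_of_int b))"

lemma real_point_le_iff: "real_point u \<le> real_point v \<longleftrightarrow> u \<le> v"
  by (auto simp: real_point_def less_eq_prod_def split: prod.split)

lemma inj_real_point: "inj real_point"
  by (auto simp: real_point_def inj_def)

lemma chain_real_point_iff:
  "Complete_Partial_Order.chain (\<le>) (real_point ` C) \<longleftrightarrow> Complete_Partial_Order.chain (\<le>) C"
  by (auto simp: chain_def real_point_le_iff)

lemma card_real_point: "card (real_point ` C) = card C"
  using inj_real_point by (intro card_image) (auto intro: inj_on_subset)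

text \<open>With \<open>d = D + 1\<close> the terms \<open>d choose 2\<close> and
  \<open>(d - 1) * card L\<close> are precisely the corrections in
  \<open>card_comparable_pairs\<close>, and everything but the pairs of cells cancels.\<close>

lemma coeff_chain_polynomial_planar_lattice:
  assumes L: "planar_lattice L" and b: "b \<in> L" and t: "t \<in> L" and bt: "\<And>v. v \<in> L \<Longrightarrow> b \<le> v \<and> v \<le> t"
  shows "poly.coeff (chain_polynomial (nat (coord_sum t - coord_sum b + 1)) (real_point ` L)) 2 =
    int (card {(c, c') \<in> lattice_cells L \<times> lattice_cells L. c + (1, 1) \<le> c'})"
proof -
  interpret planar_lattice L by fact
  define D where "D = coord_sum t - coord_sum b"
  define d where "d = nat (D + 1)"
  have D: "D \<ge> 0" unfolding D_def using bt[OF t] coord_sum_mono by simp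
  let ?V = "real_point ` L"
  have "{(u, v) \<in> ?V \<times> ?V. u < v} = map_prod real_point real_point ` {(u, v) \<in> L \<times> L. u < v}"
    by (force simp: less_le_not_le real_point_le_iff)
  then have pairs: "card {(u, v) \<in> ?V \<times> ?V. u < v} = card {(u, v) \<in> L \<times> L. u < v}"
    using inj_real_point by (simp only:) (intro card_image, auto intro: inj_on_subset[OF prod.inj_map])
  have "2 * int (d choose 2) = D * (D + 1)"
  proof -
    have "even (d * (d - 1))" by (cases d) auto
    then have "2 * (d choose 2) = d * (d - 1)" by (simp add: choose_two)
    then have "int (2 * (d choose 2)) = int (d * (d - 1))" by simp
    then show ?thesis using D by (simp add: d_def nat_diff_distrib algebra_simps)
  qed
  moreover have "poly.coeff (chain_polynomial d ?V) 2 = int (d choose 2) - D * int (card L) + int (card {(u, v) \<in> L \<times> L. u < v})"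
    using coeff_chain_polynomial_2[of ?V d, unfolded pairs card_real_point] finite_L D by (simp add: d_def)
  ultimately have "2 * poly.coeff (chain_polynomial d ?V) 2 =
      2 * int (card {(c, c') \<in> lattice_cells L \<times> lattice_cells L. c + (1, 1) \<le> c'})"
    using card_comparable_pairs[OF b t bt] by (simp add: D_def[symmetric])
  then show ?thesis by (simp add: d_def D_def)
qed

theorem theorem1p1:
  fixes k :: "'k::field itself" and X :: "(real \<times> real) set"
  assumes "convex_polyomino X"
    and "sublattice_of_N2 (vertex_set X)"
    and "\<not> thin X"
  shows "poly.coeff (polyomino_h_polynomial k X) 2 < poly.coeff (rook_polynomial X) 2
       \<and> polyomino_h_polynomial k X \<noteq> rook_polynomial X"
proof -
  let ?L = "integer_points X" and ?V = "vertex_set X"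
  have V: "?V = real_point ` ?L" by (simp add: vertex_set_eq real_point_def)
  interpret planar_lattice ?L using planar_lattice_integer_points[OF assms(1,2)] .
  interpret hibi ?V "polyomino_ideal X :: (real \<times> real, 'k) mpoly set"
  proof
    show "finite ?V" unfolding V using finite_L by simp
    have "?V \<subseteq> \<nat> \<times> \<nat>" using assms(2) by (simp add: sublattice_of_N2_def)
    then show "?V \<subseteq> {0..} \<times> {0..}" by (auto dest!: subsetD simp: Nats_def)
    show "inf u v \<in> ?V" "sup u v \<in> ?V" if "u \<in> ?V" "v \<in> ?V" for u v
      using assms(2) that by (auto simp: sublattice_of_N2_def)
    show "polyomino_ideal X = Idl\<^bsub>poly_ring ?V\<^esub> (join_meet_binomials ?V)"
      by (simp add: polyomino_ideal_def join_meet_binomials_def)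
  qed
  have cells: "cells X = lattice_cells ?L" using cells_eq[OF assms(1,2)] .
  have "cells X \<noteq> {}" using assms(3) by (auto simp: thin_def)
  then have "?L \<noteq> {}" using cell_corners cells by blast
  then obtain b t where bt: "b \<in> ?L" "t \<in> ?L" "\<And>v. v \<in> ?L \<Longrightarrow> b \<le> v \<and> v \<le> t"
    using bounds_exist by blast
  \<comment> \<open>The number of ranks from \<open>b\<close> to \<open>t\<close>: ranks strictly
    increase along a chain, and a saturated chain meets all of them.\<close>
  let ?d = "nat (coord_sum t - coord_sum b + 1)"
  have le: "card C \<le> ?d" if "C \<in> chain_sets ?V" for C
  proof -
    obtain C' where "C' \<subseteq> ?L" "C = real_point ` C'"
      using \<open>C \<in> chain_sets ?V\<close> unfolding chain_sets_def V by (auto simp: subset_image_iff)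
    then show ?thesis
      using that card_chain_le[OF bt(3)] by (simp add: chain_sets_def chain_real_point_iff card_real_point)
  qed
  obtain C where C: "C \<subseteq> ?L" "Complete_Partial_Order.chain (\<le>) C" "?d \<le> card C"
    using maximal_chain_exists[OF bt(1,2)] bt(3)[OF bt(1)] by blast
  then have C': "real_point ` C \<in> chain_sets ?V"
    by (auto simp: chain_sets_def chain_real_point_iff V)
  then have "card (real_point ` C) = ?d"
    using le[OF C'] C(3) by (simp add: card_real_point)
  then have "polyomino_h_polynomial k X = chain_polynomial ?d ?V"
    unfolding polyomino_h_polynomial_def polyomino_algebra_def polyomino_class_def
    using h_polynomial_A[OF le C'] by simp
  then have "poly.coeff (polyomino_h_polynomial k X) 2 = int (card {(c, c') \<in> cells X \<times> cells X. c + (1, 1) \<le> c'})"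
    using coeff_chain_polynomial_planar_lattice[OF planar_lattice_axioms bt] cells V by simp
  also have "\<dots> < int (rook_number X 2)"
    using rook_number_2_gt[OF assms] by simp
  also have "\<dots> = poly.coeff (rook_polynomial X) 2"
    using coeff_rook_polynomial_2[of X] finite_cells rook_number_2_gt[OF assms] cells by simp
  finally show ?thesis by auto
qed

end
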